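(* Let $\mathfrak{a}=\mathfrak a_0\oplus\mathfrak a_1$ be a Lie antialgebra over $\mathbb K$, with enveloping algebra $\mathcal{U}(\mathfrak{a})$ and canonical map $\iota:\mathfrak{a}\to\mathcal{U}(\mathfrak{a})$. Let $\mathcal{A}$ be a $\mathbb{Z}_2$-graded (unital) associative algebra and $\phi:\mathfrak{a}\to\mathcal{A}$ a linear map satisfying $$\phi(xy)=\tfrac12\big(\phi(x)\phi(y)+(-1)^{\bar x\bar y}\phi(y)\phi(x)\big)\quad\text{for all }x,y\in\mathfrak{a}_0\cup\mathfrak{a}_1,$$ and $\phi(x)\phi(y)=\phi(y)\phi(x)$ for all $x,y\in\mathfrak{a}_0$. Then there exists a unique morphism of (unital) algebras $\phi':\mathcal{U}(\mathfrak{a})\to\mathcal{A}$ such that $\phi'\circ\iota=\phi$.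
   Context: $\mathbb{K}=\mathbb{R}$ or $\mathbb{C}$. A superalgebra is a (not necessarily associative) $\mathbb{Z}_2$-graded algebra $\mathfrak{a}=\mathfrak{a}_0\oplus\mathfrak{a}_1$; it is supercommutative if $a\cdot b=(-1)^{\bar a\bar b}b\cdot a$ for homogeneous $a,b$. A Lie antialgebra is a supercommutative superalgebra $\mathfrak{a}=\mathfrak{a}_0\oplus\mathfrak{a}_1$ such that, for all $x,x_i\in\mathfrak{a}_0$ and $y,y_i\in\mathfrak{a}_1$: (LA0) $x_1(x_2x_3)=(x_1x_2)x_3$; (LA1) $x_1(x_2y)=\frac12(x_1x_2)y$; (LA2) $x(y_1y_2)=(xy_1)y_2+y_1(xy_2)$; (LA3) $y_1(y_2y_3)+y_2(y_3y_1)+y_3(y_1y_2)=0$. $\mathcal{U}(\mathfrak{a}):=\mathcal{T}(\mathfrak{a})/\langle\mathcal{P}\rangle$, where $\mathcal{T}(\mathfrak{a})=\bigoplus_{n\ge0}\mathfrak a^{\otimes n}$ is the (unital) tensor algebra and $\langle\mathcal{P}\rangle$ is the two-sided ideal generated by $\frac12(a\otimes b-b\otimes a)-ab$, $\ \frac12(a\otimes x+x\otimes a)-ax$, $\ x\otimes y-xy$, for $a,b\in\mathfrak{a}_1$, $x,y\in\mathfrak{a}_0$. The map $\iota$ is the composition $\mathfrak{a}=\mathfrak{a}^{\otimes1}\hookrightarrow\mathcal{T}(\mathfrak{a})\twoheadrightarrow\mathcal{U}(\mathfrak{a})$. *)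

theory Defs
  imports
    "HOL-Analysis.Analysis"
    "HOL-Library.Z2"
    "HOL-Algebra.QuotRing"
    "HOL-Algebra.Module"
    "HOL-Algebra.Algebraic_Closure_Type"
begin

text \<open>
  The ground field is a type of class \<^class>\<open>real_normed_field\<close>. Besides \<^typ>\<open>real\<close> and
  \<^typ>\<open>complex\<close> this class has, up to isomorphism, no other members (Gelfand--Mazur), so a
  universally quantified such type is exactly a field that is either the reals or the complex
  numbers.

  Algebras over it are \<^typ>\<open>('k, 'a) module\<close> records, which carry a multiplication and a scalar
  multiplication. For algebras that are not assumed unital the field \<^const>\<open>one\<close> is ignored.
\<close>

abbreviation scalars :: "'k::real_normed_field ring"
  where "scalars \<equiv> ring_of_type_algebra"

subsection \<open>Superalgebras and Lie antialgebras\<close>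

text \<open>The component of parity \<open>i\<close> of the algebra is \<open>G i\<close>.\<close>

locale superalgebra = module scalars \<aa>
  for \<aa> :: "('k::real_normed_field, 'a) module" (structure) and G :: "bit \<Rightarrow> 'a set" +
  assumes mult_closed: "\<lbrakk>x \<in> carrier \<aa>; y \<in> carrier \<aa>\<rbrakk> \<Longrightarrow> x \<otimes> y \<in> carrier \<aa>"
    and mult_add_left:
      "\<lbrakk>x \<in> carrier \<aa>; y \<in> carrier \<aa>; z \<in> carrier \<aa>\<rbrakk> \<Longrightarrow> (x \<oplus> y) \<otimes> z = x \<otimes> z \<oplus> y \<otimes> z"
    and mult_add_right:
      "\<lbrakk>x \<in> carrier \<aa>; y \<in> carrier \<aa>; z \<in> carrier \<aa>\<rbrakk> \<Longrightarrow> x \<otimes> (y \<oplus> z) = x \<otimes> y \<oplus> x \<otimes> z"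
    and mult_smult_left:
      "\<lbrakk>x \<in> carrier \<aa>; y \<in> carrier \<aa>\<rbrakk> \<Longrightarrow> (c \<odot> x) \<otimes> y = c \<odot> (x \<otimes> y)"
    and mult_smult_right:
      "\<lbrakk>x \<in> carrier \<aa>; y \<in> carrier \<aa>\<rbrakk> \<Longrightarrow> x \<otimes> (c \<odot> y) = c \<odot> (x \<otimes> y)"
    and submodule_component: "submodule (G i) scalars \<aa>"
    and carrier_eq_sum: "carrier \<aa> = G 0 <+> G 1"
    and components_Int: "G 0 \<inter> G 1 = {\<zero>}"
    and mult_component: "\<lbrakk>x \<in> G i; y \<in> G j\<rbrakk> \<Longrightarrow> x \<otimes> y \<in> G (i + j)"

definition koszul_sign :: "bit \<Rightarrow> bit \<Rightarrow> 'k::real_normed_field"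
  where "koszul_sign i j = (if i * j = 1 then - 1 else 1)"

locale lie_antialgebra = superalgebra +
  assumes supercommutative:
      "\<lbrakk>x \<in> G i; y \<in> G j\<rbrakk> \<Longrightarrow> x \<otimes> y = koszul_sign i j \<odot> (y \<otimes> x)"
    and LA0: "\<lbrakk>x1 \<in> G 0; x2 \<in> G 0; x3 \<in> G 0\<rbrakk> \<Longrightarrow> x1 \<otimes> (x2 \<otimes> x3) = (x1 \<otimes> x2) \<otimes> x3"
    and LA1: "\<lbrakk>x1 \<in> G 0; x2 \<in> G 0; y \<in> G 1\<rbrakk> \<Longrightarrow> x1 \<otimes> (x2 \<otimes> y) = (1/2) \<odot> ((x1 \<otimes> x2) \<otimes> y)"
    and LA2: "\<lbrakk>x \<in> G 0; y1 \<in> G 1; y2 \<in> G 1\<rbrakk>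
      \<Longrightarrow> x \<otimes> (y1 \<otimes> y2) = (x \<otimes> y1) \<otimes> y2 \<oplus> y1 \<otimes> (x \<otimes> y2)"
    and LA3: "\<lbrakk>y1 \<in> G 1; y2 \<in> G 1; y3 \<in> G 1\<rbrakk>
      \<Longrightarrow> y1 \<otimes> (y2 \<otimes> y3) \<oplus> y2 \<otimes> (y3 \<otimes> y1) \<oplus> y3 \<otimes> (y1 \<otimes> y2) = \<zero>"

locale assoc_superalgebra = superalgebra + ring \<aa>

subsection \<open>Linear maps and morphisms\<close>

definition linear_maps ::
    "('k, 'a) module \<Rightarrow> ('k, 'b) module \<Rightarrow> ('a \<Rightarrow> 'b) set"
  where "linear_maps M N = {h. h \<in> carrier M \<rightarrow> carrier N \<and>
    (\<forall>x\<in>carrier M. \<forall>y\<in>carrier M. h (x \<oplus>\<^bsub>M\<^esub> y) = h x \<oplus>\<^bsub>N\<^esub> h y) \<and>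
    (\<forall>c. \<forall>x\<in>carrier M. h (c \<odot>\<^bsub>M\<^esub> x) = c \<odot>\<^bsub>N\<^esub> h x)}"

definition unital_algebra_homs ::
    "('k, 'a) module \<Rightarrow> ('k, 'b) module \<Rightarrow> ('a \<Rightarrow> 'b) set"
  where "unital_algebra_homs M N = ring_hom M N \<inter> linear_maps M N"

subsection \<open>The tensor algebra\<close>

definition module_span :: "('k::real_normed_field, 'a) module \<Rightarrow> 'a set \<Rightarrow> 'a set"
  where "module_span M S = \<Inter>{H. submodule H scalars M \<and> S \<subseteq> H}"

text \<open>The quotient by a submodule; its multiplication is meaningful only if \<open>I\<close> is an ideal.\<close>

definition quot_module :: "('k, 'a) module \<Rightarrow> 'a set \<Rightarrow> ('k, 'a set) module"
  where "quot_module M I =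
    \<lparr>carrier = carrier (M Quot I),
     mult = mult (M Quot I),
     one = one (M Quot I),
     zero = zero (M Quot I),
     add = add (M Quot I),
     smult = (\<lambda>c B. \<Union>x\<in>B. I +>\<^bsub>M\<^esub> (c \<odot>\<^bsub>M\<^esub> x))\<rparr>"

definition single_word :: "'a list \<Rightarrow> 'a list \<Rightarrow> 'k::real_normed_field"
  where "single_word u = (\<lambda>w. if w = u then 1 else 0)"

text \<open>
  Formal linear combinations of words in the elements of \<open>M\<close>, i.e. the direct sum over \<open>n\<close> of the
  free vector spaces on the sets of \<open>n\<close>-tuples, with concatenation as multiplication.
\<close>

definition word_algebra ::
    "('k::real_normed_field, 'a) module \<Rightarrow> ('k, 'a list \<Rightarrow> 'k) module"
  where "word_algebra M =
    \<lparr>carrier = {f. finite {w. f w \<noteq> 0} \<and> {w. f w \<noteq> 0} \<subseteq> lists (carrier M)},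
     mult = (\<lambda>f g w. \<Sum>i\<le>length w. f (take i w) * g (drop i w)),
     one = single_word [],
     zero = (\<lambda>w. 0),
     add = (\<lambda>f g w. f w + g w),
     smult = (\<lambda>c f w. c * f w)\<rparr>"

definition free_tuples ::
    "('k::real_normed_field, 'a) module \<Rightarrow> nat \<Rightarrow> ('k, 'a list \<Rightarrow> 'k) module"
  where "free_tuples M n = (word_algebra M)
    \<lparr>carrier := {f \<in> carrier (word_algebra M). \<forall>w. f w \<noteq> 0 \<longrightarrow> length w = n}\<rparr>"

definition multilinear_relations ::
    "('k::real_normed_field, 'a) module \<Rightarrow> nat \<Rightarrow> ('a list \<Rightarrow> 'k) set"
  where "multilinear_relations M n = module_span (free_tuples M n)
    {(\<lambda>w. single_word (u @ [c \<odot>\<^bsub>M\<^esub> x \<oplus>\<^bsub>M\<^esub> d \<odot>\<^bsub>M\<^esub> y] @ v) w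
        - c * single_word (u @ [x] @ v) w - d * single_word (u @ [y] @ v) w) | c d x y u v.
      x \<in> carrier M \<and> y \<in> carrier M \<and> u \<in> lists (carrier M) \<and> v \<in> lists (carrier M) \<and>
      length u + 1 + length v = n}"

definition tensor_power ::
    "('k::real_normed_field, 'a) module \<Rightarrow> nat \<Rightarrow> ('k, ('a list \<Rightarrow> 'k) set) module"
  where "tensor_power M n = quot_module (free_tuples M n) (multilinear_relations M n)"

text \<open>
  The product of a class in the \<open>i\<close>-th and a class in the \<open>j\<close>-th tensor power, where \<open>n = i + j\<close>.
\<close>

definition tensor_concat ::
    "('k::real_normed_field, 'a) module \<Rightarrow> nat \<Rightarrow>
     ('a list \<Rightarrow> 'k) set \<Rightarrow> ('a list \<Rightarrow> 'k) set \<Rightarrow> ('a list \<Rightarrow> 'k) set"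
  where "tensor_concat M n B C =
    (\<Union>f\<in>B. \<Union>g\<in>C. multilinear_relations M n +>\<^bsub>free_tuples M n\<^esub> (f \<otimes>\<^bsub>word_algebra M\<^esub> g))"

text \<open>\<open>pure_tensor M [v\<^sub>1, \<dots>, v\<^sub>n]\<close> is \<open>v\<^sub>1 \<otimes> \<dots> \<otimes> v\<^sub>n\<close>, placed in degree \<open>n\<close>.\<close>

definition pure_tensor ::
    "('k::real_normed_field, 'a) module \<Rightarrow> 'a list \<Rightarrow> nat \<Rightarrow> ('a list \<Rightarrow> 'k) set"
  where "pure_tensor M u = (\<lambda>n.
    if n = length u then multilinear_relations M n +>\<^bsub>free_tuples M n\<^esub> single_word u
    else \<zero>\<^bsub>tensor_power M n\<^esub>)"

definition tensor_algebra ::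
    "('k::real_normed_field, 'a) module \<Rightarrow> ('k, nat \<Rightarrow> ('a list \<Rightarrow> 'k) set) module"
  where "tensor_algebra M =
    \<lparr>carrier = {t. (\<forall>n. t n \<in> carrier (tensor_power M n)) \<and>
                   finite {n. t n \<noteq> \<zero>\<^bsub>tensor_power M n\<^esub>}},
     mult = (\<lambda>s t n. \<Oplus>\<^bsub>tensor_power M n\<^esub>i\<in>{..n}. tensor_concat M n (s i) (t (n - i))),
     one = pure_tensor M [],
     zero = (\<lambda>n. \<zero>\<^bsub>tensor_power M n\<^esub>),
     add = (\<lambda>s t n. s n \<oplus>\<^bsub>tensor_power M n\<^esub> t n),
     smult = (\<lambda>c t n. c \<odot>\<^bsub>tensor_power M n\<^esub> t n)\<rparr>"

subsection \<open>The enveloping algebra\<close>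

definition enveloping_relations ::
    "('k::real_normed_field, 'a) module \<Rightarrow> (bit \<Rightarrow> 'a set) \<Rightarrow>
     (nat \<Rightarrow> ('a list \<Rightarrow> 'k) set) set"
  where "enveloping_relations \<aa> G =
    (let T = tensor_algebra \<aa>; j = (\<lambda>v. pure_tensor \<aa> [v]) in
      {(1/2) \<odot>\<^bsub>T\<^esub> (j a \<otimes>\<^bsub>T\<^esub> j b \<ominus>\<^bsub>T\<^esub> j b \<otimes>\<^bsub>T\<^esub> j a) \<ominus>\<^bsub>T\<^esub> j (a \<otimes>\<^bsub>\<aa>\<^esub> b)
        | a b. a \<in> G 1 \<and> b \<in> G 1} \<union>
      {(1/2) \<odot>\<^bsub>T\<^esub> (j a \<otimes>\<^bsub>T\<^esub> j x \<oplus>\<^bsub>T\<^esub> j x \<otimes>\<^bsub>T\<^esub> j a) \<ominus>\<^bsub>T\<^esub> j (a \<otimes>\<^bsub>\<aa>\<^esub> x)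
        | a x. a \<in> G 1 \<and> x \<in> G 0} \<union>
      {j x \<otimes>\<^bsub>T\<^esub> j y \<ominus>\<^bsub>T\<^esub> j (x \<otimes>\<^bsub>\<aa>\<^esub> y)
        | x y. x \<in> G 0 \<and> y \<in> G 0})"

definition enveloping_ideal ::
    "('k::real_normed_field, 'a) module \<Rightarrow> (bit \<Rightarrow> 'a set) \<Rightarrow>
     (nat \<Rightarrow> ('a list \<Rightarrow> 'k) set) set"
  where "enveloping_ideal \<aa> G = Idl\<^bsub>tensor_algebra \<aa>\<^esub> (enveloping_relations \<aa> G)"

definition enveloping_algebra ::
    "('k::real_normed_field, 'a) module \<Rightarrow> (bit \<Rightarrow> 'a set) \<Rightarrow>
     ('k, (nat \<Rightarrow> ('a list \<Rightarrow> 'k) set) set) module"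
  where "enveloping_algebra \<aa> G = quot_module (tensor_algebra \<aa>) (enveloping_ideal \<aa> G)"

definition enveloping_map ::
    "('k::real_normed_field, 'a) module \<Rightarrow> (bit \<Rightarrow> 'a set) \<Rightarrow>
     'a \<Rightarrow> (nat \<Rightarrow> ('a list \<Rightarrow> 'k) set) set"
  where "enveloping_map \<aa> G v = enveloping_ideal \<aa> G +>\<^bsub>tensor_algebra \<aa>\<^esub> pure_tensor \<aa> [v]"

end

theory Submission
  imports Defs
begin

text \<open>
  The algebra of words \<open>W\<close>, spanned freely by all words in the elements of \<open>\<aa>\<close>, is an associative
  unital algebra in which any map \<open>\<phi>\<close> on letters extends uniquely to an algebra morphism into \<open>A\<close>.
  Passing to classes modulo the multilinear relations, degree by degree, is a surjective morphism
  from \<open>W\<close> onto the tensor algebra; hence the latter inherits the algebra axioms from \<open>W\<close>. If \<open>\<phi>\<close>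
  is linear, its extension to \<open>W\<close> vanishes on the multilinear relations and so factors through the
  tensor algebra. The two conditions on \<open>\<phi>\<close> say that the kernel of the resulting morphism, a
  two-sided ideal, contains the defining relations of the enveloping algebra, so it factors once
  more. Uniqueness holds because all maps involved are surjective and a morphism on \<open>W\<close> is determined
  by its values on letters.
\<close>

text \<open>The product of the tensor algebra is, in each degree, a sum of unions of cosets, on
  which associativity is awkward to check directly; on \<open>W\<close> the same law is an identity
  between finite sums of scalars. The price is independence of representatives: the multilinear
  relations of all degrees together must absorb multiplication from both sides. They are given as
  one submodule per degree, so an evaluation is shown to respect equality of classes by cutting an
  element of \<open>W\<close> into its finitely many homogeneous parts. The relation for two even
  elements is x \<otimes> y - xy, without the half-sum that the mixed relation has. The half-sum
  condition on \<phi> yields it only after the two products \<phi> x \<phi> y and \<phi> y \<phi> x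
  are known to agree, which is what the second condition on \<phi> provides.\<close>

lemma scalars_simps [simp]:
  "carrier scalars = UNIV" "a \<otimes>\<^bsub>scalars\<^esub> b = a * b" "\<one>\<^bsub>scalars\<^esub> = 1"
  "\<zero>\<^bsub>scalars\<^esub> = 0" "a \<oplus>\<^bsub>scalars\<^esub> b = a + b"
  by (simp_all add: ring_of_type_algebra_def)

lemma cring_scalars: "cring (scalars :: 'k::real_normed_field ring)"
  by (rule cring_from_type_algebra)

text \<open>The common kind of the word algebra, the tensor algebra, the enveloping algebra and the
  target. The axioms are checked by computation for words only; the tensor and the enveloping
  algebra receive them through \<open>unital_algebra_image\<close>.\<close>

locale unital_algebra = module scalars M + ring M
  for M :: "('k::real_normed_field, 'a) module" (structure) +
  assumes mult_smult_left: "\<lbrakk>x \<in> carrier M; y \<in> carrier M\<rbrakk> \<Longrightarrow> (c \<odot> x) \<otimes> y = c \<odot> (x \<otimes> y)"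
    and mult_smult_right: "\<lbrakk>x \<in> carrier M; y \<in> carrier M\<rbrakk> \<Longrightarrow> x \<otimes> (c \<odot> y) = c \<odot> (x \<otimes> y)"

lemma (in assoc_superalgebra) unital_algebra: "unital_algebra \<aa>"
  by (intro unital_algebra.intro unital_algebra_axioms.intro mult_smult_left mult_smult_right
      module_axioms ring_axioms)

subsection \<open>Algebra homomorphisms\<close>

lemma unital_algebra_homsI:
  assumes "\<And>x. x \<in> carrier M \<Longrightarrow> h x \<in> carrier N"
    and "\<And>x y. \<lbrakk>x \<in> carrier M; y \<in> carrier M\<rbrakk> \<Longrightarrow> h (x \<otimes>\<^bsub>M\<^esub> y) = h x \<otimes>\<^bsub>N\<^esub> h y"
    and "\<And>x y. \<lbrakk>x \<in> carrier M; y \<in> carrier M\<rbrakk> \<Longrightarrow> h (x \<oplus>\<^bsub>M\<^esub> y) = h x \<oplus>\<^bsub>N\<^esub> h y"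
    and "h \<one>\<^bsub>M\<^esub> = \<one>\<^bsub>N\<^esub>"
    and "\<And>c x. x \<in> carrier M \<Longrightarrow> h (c \<odot>\<^bsub>M\<^esub> x) = c \<odot>\<^bsub>N\<^esub> h x"
  shows "h \<in> unital_algebra_homs M N"
  using assms by (auto simp: unital_algebra_homs_def ring_hom_def linear_maps_def)

lemma unital_algebra_homsD:
  assumes "h \<in> unital_algebra_homs M N"
  shows "x \<in> carrier M \<Longrightarrow> h x \<in> carrier N"
    and "\<lbrakk>x \<in> carrier M; y \<in> carrier M\<rbrakk> \<Longrightarrow> h (x \<otimes>\<^bsub>M\<^esub> y) = h x \<otimes>\<^bsub>N\<^esub> h y"
    and "\<lbrakk>x \<in> carrier M; y \<in> carrier M\<rbrakk> \<Longrightarrow> h (x \<oplus>\<^bsub>M\<^esub> y) = h x \<oplus>\<^bsub>N\<^esub> h y"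
    and "h \<one>\<^bsub>M\<^esub> = \<one>\<^bsub>N\<^esub>"
    and "x \<in> carrier M \<Longrightarrow> h (c \<odot>\<^bsub>M\<^esub> x) = c \<odot>\<^bsub>N\<^esub> h x"
  using assms by (auto simp: unital_algebra_homs_def ring_hom_def linear_maps_def)

lemma unital_algebra_homs_comp:
  assumes "g \<in> unital_algebra_homs M N" "h \<in> unital_algebra_homs N P"
  shows "h \<circ> g \<in> unital_algebra_homs M P"
  by (rule unital_algebra_homsI)
    (simp_all add: unital_algebra_homsD[OF assms(1)] unital_algebra_homsD[OF assms(2)])

lemma unital_algebra_homs_ring_hom_ring:
  assumes "h \<in> unital_algebra_homs M N" "ring M" "ring N"
  shows "ring_hom_ring M N h"
  using assms by (intro ring_hom_ringI2) (auto simp: unital_algebra_homs_def)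

lemma unital_algebra_homs_zero:
  assumes "h \<in> unital_algebra_homs M N" "ring M" "ring N"
  shows "h \<zero>\<^bsub>M\<^esub> = \<zero>\<^bsub>N\<^esub>"
  by (rule ring_hom_zero[OF _ assms(2,3)]) (use assms(1) in \<open>simp add: unital_algebra_homs_def\<close>)

text \<open>Being a morphism concerns values on the carrier alone, and the carrier is closed under
  all operations, so values elsewhere can be reset. This is how the constructed morphism becomes
  \<open>extensional\<close>.\<close>

lemma unital_algebra_homs_restrict:
  fixes M :: "('k::real_normed_field, 'a) module"
  assumes "unital_algebra M" "h \<in> unital_algebra_homs M N"
  shows "restrict h (carrier M) \<in> unital_algebra_homs M N"
proof -
  interpret unital_algebra M by fact
  show ?thesis by (rule unital_algebra_homsI) (auto simp: unital_algebra_homsD[OF assms(2)])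
qed

text \<open>The factor \<open>g\<close> applies \<open>h\<close> to a chosen preimage, and
  \<open>ker\<close> makes the choice immaterial. Phrasing \<open>ker\<close> by equal values of
  \<open>q\<close>, instead of containment of kernels, asks nothing of \<open>N\<close> or
  \<open>P\<close> and fits \<open>word_class\<close>, whose kernel is only described degree by
  degree.\<close>

lemma unital_algebra_homs_factor:
  fixes M :: "('k::real_normed_field, 'a) module"
  assumes M: "unital_algebra M"
    and q: "q \<in> unital_algebra_homs M N"
    and surj: "q ` carrier M = carrier N"
    and h: "h \<in> unital_algebra_homs M P"
    and ker: "\<And>x y. \<lbrakk>x \<in> carrier M; y \<in> carrier M; q x = q y\<rbrakk> \<Longrightarrow> h x = h y"
  shows "\<exists>g \<in> unital_algebra_homs N P. \<forall>x\<in>carrier M. g (q x) = h x"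
proof -
  interpret unital_algebra M by (rule M)
  note qD = unital_algebra_homsD[OF q] and hD = unital_algebra_homsD[OF h]
  define g where "g = h \<circ> inv_into (carrier M) q"
  have g: "g (q x) = h x" if "x \<in> carrier M" for x
    unfolding g_def comp_def
    by (rule ker) (auto intro!: inv_into_into f_inv_into_f that)
  have "g \<in> unital_algebra_homs N P"
  proof (rule unital_algebra_homsI)
    show "g \<one>\<^bsub>N\<^esub> = \<one>\<^bsub>P\<^esub>" using g[of "\<one>\<^bsub>M\<^esub>"] by (simp add: qD hD)
  next
    fix z assume "z \<in> carrier N"
    then obtain x where x: "x \<in> carrier M" "z = q x" using surj by blast
    show "g z \<in> carrier P" using x by (simp add: g hD)
    show "g (c \<odot>\<^bsub>N\<^esub> z) = c \<odot>\<^bsub>P\<^esub> g z" for c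
      using x g[of "c \<odot>\<^bsub>M\<^esub> x"] by (simp add: g hD qD)
  next
    fix z w assume "z \<in> carrier N" "w \<in> carrier N"
    then obtain x y where x: "x \<in> carrier M" "z = q x" and y: "y \<in> carrier M" "w = q y"
      using surj by blast
    show "g (z \<otimes>\<^bsub>N\<^esub> w) = g z \<otimes>\<^bsub>P\<^esub> g w"
      using x y g[of "x \<otimes>\<^bsub>M\<^esub> y"] by (simp add: g hD qD)
    show "g (z \<oplus>\<^bsub>N\<^esub> w) = g z \<oplus>\<^bsub>P\<^esub> g w"
      using x y g[of "x \<oplus>\<^bsub>M\<^esub> y"] by (simp add: g hD qD)
  qed
  then show ?thesis using g by blast
qed

text \<open>The identities of an algebra pass along a surjection that commutes with the operations.
  The image of zero is a separate premise: \<open>unital_algebra_homs\<close> does not mention zero,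
  and deriving it would presuppose that \<open>N\<close> is a group.\<close>

lemma unital_algebra_image:
  fixes M :: "('k::real_normed_field, 'a) module" and N :: "('k, 'b) module"
  assumes M: "unital_algebra M"
    and q: "q \<in> unital_algebra_homs M N"
    and surj: "q ` carrier M = carrier N"
    and zero: "q \<zero>\<^bsub>M\<^esub> = \<zero>\<^bsub>N\<^esub>"
  shows "unital_algebra N"
proof -
  interpret M: unital_algebra M by (rule M)
  note qD = unital_algebra_homsD[OF q]
  have "q \<in> ring_hom M N" using q by (simp add: unital_algebra_homs_def)
  from M.ring_hom_imp_img_ring[OF this] have ring: "ring N" by (simp add: surj zero)
  interpret N: ring N by (rule ring)
  have rep: "\<exists>x\<in>carrier M. z = q x" if "z \<in> carrier N" for z using surj that by blast
  show ?thesis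
  proof (intro unital_algebra.intro unital_algebra_axioms.intro moduleI cring_scalars ring
      N.abelian_group_axioms)
    fix a :: 'k and z assume "z \<in> carrier N"
    then obtain x where x: "x \<in> carrier M" "z = q x" using rep by blast
    show "a \<odot>\<^bsub>N\<^esub> z \<in> carrier N" using x qD(1)[of "a \<odot>\<^bsub>M\<^esub> x"] by (simp add: qD)
    show "\<one>\<^bsub>scalars\<^esub> \<odot>\<^bsub>N\<^esub> z = z" 
      using qD(5)[OF x(1), of 1] M.smult_one[OF x(1)] by (simp only: x scalars_simps)
    show "(a \<oplus>\<^bsub>scalars\<^esub> b) \<odot>\<^bsub>N\<^esub> z = a \<odot>\<^bsub>N\<^esub> z \<oplus>\<^bsub>N\<^esub> b \<odot>\<^bsub>N\<^esub> z" for b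
      using x M.smult_l_distr[of a b x] qD(5)[of x "a + b"] by (simp add: qD)
    show "(a \<otimes>\<^bsub>scalars\<^esub> b) \<odot>\<^bsub>N\<^esub> z = a \<odot>\<^bsub>N\<^esub> (b \<odot>\<^bsub>N\<^esub> z)" for b
      using x M.smult_assoc1[of a b x] qD(5)[of x "a * b"] qD(5)[of "b \<odot>\<^bsub>M\<^esub> x" a]
      by (simp add: qD(5))
  next
    fix a :: 'k and z w assume "z \<in> carrier N" "w \<in> carrier N"
    then obtain x y where x: "x \<in> carrier M" "z = q x" and y: "y \<in> carrier M" "w = q y"
      using rep by blast
    have ax: "a \<odot>\<^bsub>M\<^esub> x \<in> carrier M" "a \<odot>\<^bsub>M\<^esub> y \<in> carrier M" using x y by simp_all
    have "a \<odot>\<^bsub>N\<^esub> (z \<oplus>\<^bsub>N\<^esub> w) = q (a \<odot>\<^bsub>M\<^esub> (x \<oplus>\<^bsub>M\<^esub> y))"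
      by (simp only: x y qD M.a_closed)
    also have "\<dots> = a \<odot>\<^bsub>N\<^esub> z \<oplus>\<^bsub>N\<^esub> a \<odot>\<^bsub>N\<^esub> w"
      using x y by (simp only: M.smult_r_distr scalars_simps UNIV_I qD ax)
    finally show "a \<odot>\<^bsub>N\<^esub> (z \<oplus>\<^bsub>N\<^esub> w) = a \<odot>\<^bsub>N\<^esub> z \<oplus>\<^bsub>N\<^esub> a \<odot>\<^bsub>N\<^esub> w" .
    have "a \<odot>\<^bsub>N\<^esub> z \<otimes>\<^bsub>N\<^esub> w = q (a \<odot>\<^bsub>M\<^esub> x \<otimes>\<^bsub>M\<^esub> y)"
      by (simp only: x y qD ax)
    also have "\<dots> = a \<odot>\<^bsub>N\<^esub> (z \<otimes>\<^bsub>N\<^esub> w)"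
      using x y by (simp only: M.mult_smult_left qD M.m_closed)
    finally show "a \<odot>\<^bsub>N\<^esub> z \<otimes>\<^bsub>N\<^esub> w = a \<odot>\<^bsub>N\<^esub> (z \<otimes>\<^bsub>N\<^esub> w)" .
    have "z \<otimes>\<^bsub>N\<^esub> (a \<odot>\<^bsub>N\<^esub> w) = q (x \<otimes>\<^bsub>M\<^esub> (a \<odot>\<^bsub>M\<^esub> y))"
      by (simp only: x y qD ax)
    also have "\<dots> = a \<odot>\<^bsub>N\<^esub> (z \<otimes>\<^bsub>N\<^esub> w)"
      using x y by (simp only: M.mult_smult_right qD M.m_closed)
    finally show "z \<otimes>\<^bsub>N\<^esub> (a \<odot>\<^bsub>N\<^esub> w) = a \<odot>\<^bsub>N\<^esub> (z \<otimes>\<^bsub>N\<^esub> w)" .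
  qed
qed

subsection \<open>Spans and quotients\<close>

lemma smult_minus_one:
  assumes "module scalars M" "x \<in> carrier M"
  shows "(-1) \<odot>\<^bsub>M\<^esub> x = \<ominus>\<^bsub>M\<^esub> x"
proof -
  interpret M: module scalars M by (rule assms(1))
  have "(-1) \<odot>\<^bsub>M\<^esub> x \<oplus>\<^bsub>M\<^esub> 1 \<odot>\<^bsub>M\<^esub> x = \<zero>\<^bsub>M\<^esub>"
    using M.smult_l_distr[of "-1" 1 x] M.smult_l_null[of x] assms(2) by simp
  then have "\<ominus>\<^bsub>M\<^esub> x = (-1) \<odot>\<^bsub>M\<^esub> x"
    using M.smult_one[of x] M.smult_closed[of "-1" x] assms(2) by (intro M.minus_equality) simp_all
  then show ?thesis by simp
qed

text \<open>Closure under negatives is absorbed by closure under scalars, as negation is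
  multiplication by -1.\<close>

lemma submodule_scalarsI:
  assumes M: "module scalars M" and sub: "H \<subseteq> carrier M" and "\<zero>\<^bsub>M\<^esub> \<in> H"
    and "\<And>x y. \<lbrakk>x \<in> H; y \<in> H\<rbrakk> \<Longrightarrow> x \<oplus>\<^bsub>M\<^esub> y \<in> H"
    and smult: "\<And>c x. x \<in> H \<Longrightarrow> c \<odot>\<^bsub>M\<^esub> x \<in> H"
  shows "submodule H scalars M"
proof (rule module.submoduleI[OF M])
  fix x assume "x \<in> H"
  then show "\<ominus>\<^bsub>M\<^esub> x \<in> H"
    using smult[of x "-1"] smult_minus_one[OF M, of x] sub by auto
qed (use assms in auto)

lemma module_span_superset: "S \<subseteq> module_span M S"
  by (auto simp: module_span_def)

lemma module_span_minimal: "\<lbrakk>submodule H scalars M; S \<subseteq> H\<rbrakk> \<Longrightarrow> module_span M S \<subseteq> H"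
  by (auto simp: module_span_def)

text \<open>The premise on \<open>S\<close> makes the carrier one of the intersected submodules. If
  \<open>S\<close> left the carrier, the family would be empty and its intersection the whole
  type.\<close>

lemma submodule_module_span:
  assumes "module scalars M" "S \<subseteq> carrier M"
  shows "submodule (module_span M S) scalars M"
proof -
  interpret module scalars M by (rule assms)
  show ?thesis
  proof (rule submoduleI)
    show "module_span M S \<subseteq> carrier M"
      by (rule module_span_minimal[OF carrier_is_submodule assms(2)])
    show "\<zero>\<^bsub>M\<^esub> \<in> module_span M S"
      by (auto simp: module_span_def dest!: submodule.axioms(1) subgroup.one_closed)
  qed (auto simp: module_span_def intro: submoduleE(3,5) submodule.smult_closed)
qed

lemma abelian_subgroup_submodule:
  assumes "module scalars M" "submodule I scalars M"
  shows "abelian_subgroup I M"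
  using assms by (intro abelian_subgroupI3 additive_subgroupI submodule.axioms(1)) (auto simp: module_def)

lemma quot_module_simps:
  "carrier (quot_module M I) = (\<lambda>x. I +>\<^bsub>M\<^esub> x) ` carrier M"
  "x \<otimes>\<^bsub>quot_module M I\<^esub> y = rcoset_mult M I x y"
  "\<one>\<^bsub>quot_module M I\<^esub> = I +>\<^bsub>M\<^esub> \<one>\<^bsub>M\<^esub>"
  "\<zero>\<^bsub>quot_module M I\<^esub> = I"
  by (auto simp: quot_module_def FactRing_simps)

lemma quot_module_add:
  assumes "module scalars M" "submodule I scalars M" "x \<in> carrier M" "y \<in> carrier M"
  shows "(I +>\<^bsub>M\<^esub> x) \<oplus>\<^bsub>quot_module M I\<^esub> (I +>\<^bsub>M\<^esub> y) = I +>\<^bsub>M\<^esub> (x \<oplus>\<^bsub>M\<^esub> y)"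
  using abelian_subgroup.a_rcos_sum[OF abelian_subgroup_submodule[OF assms(1,2)] assms(3,4)]
  by (simp add: quot_module_def FactRing_def)

lemma coset_eq_iff:
  assumes "module scalars M" "submodule I scalars M" "x \<in> carrier M" "y \<in> carrier M"
  shows "I +>\<^bsub>M\<^esub> x = I +>\<^bsub>M\<^esub> y \<longleftrightarrow> x \<ominus>\<^bsub>M\<^esub> y \<in> I"
proof -
  interpret abelian_subgroup I M by (rule abelian_subgroup_submodule[OF assms(1,2)])
  have "I +>\<^bsub>M\<^esub> x = I +>\<^bsub>M\<^esub> y \<longleftrightarrow> x \<in> I +>\<^bsub>M\<^esub> y"
    using a_repr_independence'[of x y] a_repr_independenceD[of x y] assms(3,4) by metis
  then show ?thesis using a_rcos_module[of y x] assms(3,4) by (simp only: a_minus_def)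
qed

lemma coset_zero:
  assumes "module scalars M" "submodule I scalars M"
  shows "I +>\<^bsub>M\<^esub> \<zero>\<^bsub>M\<^esub> = I"
proof -
  interpret abelian_subgroup I M by (rule abelian_subgroup_submodule[OF assms])
  show ?thesis by (rule a_rcos_const) simp
qed

text \<open>For y in the coset of x, the difference c y - c x = c (y - x) lies in \<open>I\<close>,
  so all cosets in the union defining the scalar multiple coincide.\<close>

lemma quot_module_smult:
  assumes M: "module scalars M" and I: "submodule I scalars M" and x: "x \<in> carrier M"
  shows "c \<odot>\<^bsub>quot_module M I\<^esub> (I +>\<^bsub>M\<^esub> x) = I +>\<^bsub>M\<^esub> (c \<odot>\<^bsub>M\<^esub> x)"
proof -
  interpret module scalars M by (rule M)
  interpret I: abelian_subgroup I M by (rule abelian_subgroup_submodule[OF M I])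
  have "I +>\<^bsub>M\<^esub> (c \<odot>\<^bsub>M\<^esub> y) = I +>\<^bsub>M\<^esub> (c \<odot>\<^bsub>M\<^esub> x)" if "y \<in> I +>\<^bsub>M\<^esub> x" for y
  proof -
    have y: "y \<in> carrier M" using I.a_elemrcos_carrier[OF x that] .
    have "y \<oplus>\<^bsub>M\<^esub> \<ominus>\<^bsub>M\<^esub> x \<in> I" by (rule I.a_rcos_module_imp[OF x that])
    then have "c \<odot>\<^bsub>M\<^esub> (y \<oplus>\<^bsub>M\<^esub> \<ominus>\<^bsub>M\<^esub> x) \<in> I" using submodule.smult_closed[OF I] by simp
    then have "c \<odot>\<^bsub>M\<^esub> y \<ominus>\<^bsub>M\<^esub> c \<odot>\<^bsub>M\<^esub> x \<in> I" using x y
      by (simp add: smult_r_distr smult_r_minus a_minus_def)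
    then show ?thesis using x y by (subst coset_eq_iff[OF M I]) auto
  qed
  moreover have "x \<in> I +>\<^bsub>M\<^esub> x" by (rule I.a_rcos_self[OF x])
  ultimately have "(\<Union>y\<in>I +>\<^bsub>M\<^esub> x. I +>\<^bsub>M\<^esub> (c \<odot>\<^bsub>M\<^esub> y)) = I +>\<^bsub>M\<^esub> (c \<odot>\<^bsub>M\<^esub> x)" by blast
  then show ?thesis by (simp add: quot_module_def)
qed

lemma abelian_group_quot_module:
  assumes "module scalars M" "submodule I scalars M"
  shows "abelian_group (quot_module M I)"
proof -
  interpret abelian_subgroup I M by (rule abelian_subgroup_submodule[OF assms])
  have "abelian_group (M Quot I)"
    by (rule comm_group_abelian_groupI)
      (simp add: FactRing_def a_factorgroup_is_comm_group[unfolded A_FactGroup_def'])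
  then interpret Q: abelian_group "M Quot I" .
  show ?thesis
    using Q.add.l_inv_ex by (intro abelian_groupI) (auto simp: quot_module_def Q.a_ac)
qed

text \<open>Serves the product of the tensor algebra, which in each degree is a finite sum of
  cosets.\<close>

lemma quot_module_finsum:
  assumes M: "module scalars M" and I: "submodule I scalars M" and "finite S"
    and "\<And>i. i \<in> S \<Longrightarrow> f i \<in> carrier M"
  shows "(\<Oplus>\<^bsub>quot_module M I\<^esub>i\<in>S. I +>\<^bsub>M\<^esub> f i) = I +>\<^bsub>M\<^esub> (\<Oplus>\<^bsub>M\<^esub>i\<in>S. f i)"
  using assms(3,4)
proof (induction S rule: finite_induct)
  interpret M: module scalars M by (rule M)
  interpret Q: abelian_group "quot_module M I" by (rule abelian_group_quot_module[OF M I])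
  {
    case empty
    show ?case by (simp add: quot_module_simps coset_zero[OF M I])
  next
    case (insert j S)
    have "(\<Oplus>\<^bsub>quot_module M I\<^esub>i\<in>insert j S. I +>\<^bsub>M\<^esub> f i) =
        (I +>\<^bsub>M\<^esub> f j) \<oplus>\<^bsub>quot_module M I\<^esub> (\<Oplus>\<^bsub>quot_module M I\<^esub>i\<in>S. I +>\<^bsub>M\<^esub> f i)"
      using insert by (intro Q.finsum_insert) (auto simp: quot_module_simps)
    also have "\<dots> = I +>\<^bsub>M\<^esub> (f j \<oplus>\<^bsub>M\<^esub> (\<Oplus>\<^bsub>M\<^esub>i\<in>S. f i))"
      using insert by (simp add: quot_module_add[OF M I] Pi_def)
    also have "f j \<oplus>\<^bsub>M\<^esub> (\<Oplus>\<^bsub>M\<^esub>i\<in>S. f i) = (\<Oplus>\<^bsub>M\<^esub>i\<in>insert j S. f i)"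
      using insert by (subst M.finsum_insert) (auto simp: Pi_def)
    finally show ?case .
  }
qed

text \<open>Since c x = (c 1) x, absorbing multiplication by ring elements includes absorbing
  scalars.\<close>

lemma (in unital_algebra) ideal_submodule:
  assumes "ideal I M"
  shows "submodule I scalars M"
proof -
  interpret I: ideal I M by (rule assms)
  show ?thesis
  proof (rule submoduleI)
    fix c :: 'k and x assume "x \<in> I"
    then have "(c \<odot> \<one>) \<otimes> x \<in> I" by (intro I.I_l_closed) auto
    then show "c \<odot> x \<in> I" using \<open>x \<in> I\<close> by (simp add: mult_smult_left)
  qed (use I.a_subset in auto)
qed

lemma (in unital_algebra) quotient_hom:
  assumes I: "ideal I M"
  shows "(\<lambda>x. I +> x) \<in> unital_algebra_homs M (quot_module M I)"
proof -
  note sub = ideal_submodule[OF I]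
  show ?thesis
    by (rule unital_algebra_homsI)
      (auto simp: quot_module_simps ideal.rcoset_mult_add[OF I] quot_module_add[OF module_axioms sub]
        quot_module_smult[OF module_axioms sub])
qed

subsection \<open>The algebra of words\<close>

lemma word_algebra_carrier_iff:
  "f \<in> carrier (word_algebra M) \<longleftrightarrow> finite {w. f w \<noteq> 0} \<and> {w. f w \<noteq> 0} \<subseteq> lists (carrier M)"
  by (simp add: word_algebra_def)

lemma word_algebra_carrierI:
  assumes "finite S" "S \<subseteq> lists (carrier M)" "\<And>w. f w \<noteq> 0 \<Longrightarrow> w \<in> S"
  shows "f \<in> carrier (word_algebra M)"
  unfolding word_algebra_carrier_iff using assms by (blast intro: finite_subset)

lemma word_algebra_simps:
  "f \<otimes>\<^bsub>word_algebra M\<^esub> g = (\<lambda>w. \<Sum>i\<le>length w. f (take i w) * g (drop i w))"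
  "\<one>\<^bsub>word_algebra M\<^esub> = single_word []"
  "\<zero>\<^bsub>word_algebra M\<^esub> = (\<lambda>w. 0)"
  "f \<oplus>\<^bsub>word_algebra M\<^esub> g = (\<lambda>w. f w + g w)"
  "c \<odot>\<^bsub>word_algebra M\<^esub> f = (\<lambda>w. c * f w)"
  by (simp_all add: word_algebra_def)

lemma single_word_closed: "u \<in> lists (carrier M) \<Longrightarrow> single_word u \<in> carrier (word_algebra M)"
  by (rule word_algebra_carrierI[of "{u}"]) (auto simp: single_word_def split: if_splits)

lemma word_algebra_mult_closed:
  assumes "f \<in> carrier (word_algebra M)" "g \<in> carrier (word_algebra M)"
  shows "f \<otimes>\<^bsub>word_algebra M\<^esub> g \<in> carrier (word_algebra M)"
proof (rule word_algebra_carrierI)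
  let ?S = "(\<lambda>(u, v). u @ v) ` ({w. f w \<noteq> 0} \<times> {w. g w \<noteq> 0})"
  show "finite ?S" using assms by (auto simp: word_algebra_carrier_iff)
  show "?S \<subseteq> lists (carrier M)"
    using assms by (auto simp: word_algebra_carrier_iff dest!: subsetD)
  fix w assume "(f \<otimes>\<^bsub>word_algebra M\<^esub> g) w \<noteq> 0"
  then obtain i where "f (take i w) * g (drop i w) \<noteq> 0"
    by (auto simp: word_algebra_simps elim: sum.not_neutral_contains_not_neutral)
  then show "w \<in> ?S" by (auto intro!: image_eqI[of _ _ "(take i w, drop i w)"])
qed

lemma word_algebra_mult_assoc:
  "(f \<otimes>\<^bsub>word_algebra M\<^esub> g) \<otimes>\<^bsub>word_algebra M\<^esub> h = f \<otimes>\<^bsub>word_algebra M\<^esub> (g \<otimes>\<^bsub>word_algebra M\<^esub> h)"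
proof
  fix w
  have "((f \<otimes>\<^bsub>word_algebra M\<^esub> g) \<otimes>\<^bsub>word_algebra M\<^esub> h) w =
      (\<Sum>i\<le>length w. \<Sum>j\<le>i. f (take j w) * g (drop j (take i w)) * h (drop i w))"
    by (auto simp: word_algebra_simps sum_distrib_right min_def intro!: sum.cong)
  also have "\<dots> = (\<Sum>(i, j)\<in>Sigma {..length w} (\<lambda>i. {..i}).
      f (take j w) * g (drop j (take i w)) * h (drop i w))"
    by (rule sum.Sigma) auto
  also have "\<dots> = (\<Sum>(j, k)\<in>Sigma {..length w} (\<lambda>j. {..length w - j}).
      f (take j w) * (g (take k (drop j w)) * h (drop k (drop j w))))"
    \<comment> \<open>Both sides run over the cuts of \<open>w\<close> into three consecutive
      pieces. The left records (i, j), the end and the start of the middle piece; the right records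
      (j, k) with k its length, so i = j + k.\<close>
    by (rule sum.reindex_bij_witness[of _ "\<lambda>(j, k). (j + k, j)" "\<lambda>(i, j). (j, i - j)"])
      (auto simp: drop_take mult.assoc)
  also have "\<dots> = (\<Sum>j\<le>length w. \<Sum>k\<le>length w - j.
      f (take j w) * (g (take k (drop j w)) * h (drop k (drop j w))))"
    by (rule sum.Sigma[symmetric]) auto
  also have "\<dots> = (f \<otimes>\<^bsub>word_algebra M\<^esub> (g \<otimes>\<^bsub>word_algebra M\<^esub> h)) w"
    by (simp add: word_algebra_simps sum_distrib_left)
  finally show "((f \<otimes>\<^bsub>word_algebra M\<^esub> g) \<otimes>\<^bsub>word_algebra M\<^esub> h) w =
    (f \<otimes>\<^bsub>word_algebra M\<^esub> (g \<otimes>\<^bsub>word_algebra M\<^esub> h)) w" .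
qed

lemma single_word_mult:
  "single_word u \<otimes>\<^bsub>word_algebra M\<^esub> single_word v = single_word (u @ v)"
proof
  fix w
  have split: "take i w = u \<and> drop i w = v \<longleftrightarrow> i = length u \<and> w = u @ v" if "i \<le> length w" for i
    using that append_take_drop_id[of i w] by force
  have "(single_word u \<otimes>\<^bsub>word_algebra M\<^esub> single_word v) w =
      (\<Sum>i\<le>length w. if take i w = u \<and> drop i w = v then 1 else 0)"
    unfolding word_algebra_simps single_word_def by (rule sum.cong) auto
  also have "\<dots> = (\<Sum>i\<le>length w. if i = length u then if w = u @ v then 1 else 0 else 0)"
    using split by (intro sum.cong) auto
  also have "\<dots> = single_word (u @ v) w"
    by (auto simp: single_word_def)
  finally show "(single_word u \<otimes>\<^bsub>word_algebra M\<^esub> single_word v) w = single_word (u @ v) w" .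
qed

lemma word_algebra_mult_one:
  "single_word [] \<otimes>\<^bsub>word_algebra M\<^esub> f = f" "f \<otimes>\<^bsub>word_algebra M\<^esub> single_word [] = f"
proof -
  have "(single_word [] \<otimes>\<^bsub>word_algebra M\<^esub> f) w = f w" for w
  proof -
    have "(single_word [] \<otimes>\<^bsub>word_algebra M\<^esub> f) w = (\<Sum>i\<le>length w. if i = 0 then f w else 0)"
      unfolding word_algebra_simps single_word_def by (rule sum.cong) auto
    then show ?thesis by simp
  qed
  then show "single_word [] \<otimes>\<^bsub>word_algebra M\<^esub> f = f" by auto
  have "(f \<otimes>\<^bsub>word_algebra M\<^esub> single_word []) w = f w" for w
  proof -
    have "(f \<otimes>\<^bsub>word_algebra M\<^esub> single_word []) w =
        (\<Sum>i\<le>length w. if i = length w then f w else 0)"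
      unfolding word_algebra_simps single_word_def by (rule sum.cong) auto
    then show ?thesis by simp
  qed
  then show "f \<otimes>\<^bsub>word_algebra M\<^esub> single_word [] = f" by auto
qed

lemma unital_algebra_word_algebra:
  fixes M :: "('k::real_normed_field, 'a) module"
  shows "unital_algebra (word_algebra M)"
proof -
  let ?W = "word_algebra M"
  have add: "f \<oplus>\<^bsub>?W\<^esub> g \<in> carrier ?W" if "f \<in> carrier ?W" "g \<in> carrier ?W" for f g
    using that
    by (intro word_algebra_carrierI[of "{w. f w \<noteq> 0} \<union> {w. g w \<noteq> 0}"])
      (auto simp: word_algebra_carrier_iff word_algebra_simps)
  have smult: "c \<odot>\<^bsub>?W\<^esub> f \<in> carrier ?W" if "f \<in> carrier ?W" for f c
    using that
    by (intro word_algebra_carrierI[of "{w. f w \<noteq> 0}"])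
      (auto simp: word_algebra_carrier_iff word_algebra_simps)
  have group: "abelian_group ?W"
  proof (rule abelian_groupI)
    fix f assume f: "f \<in> carrier ?W"
    have "(-1) \<odot>\<^bsub>?W\<^esub> f \<oplus>\<^bsub>?W\<^esub> f = \<zero>\<^bsub>?W\<^esub>" by (simp add: word_algebra_simps)
    then show "\<exists>g\<in>carrier ?W. g \<oplus>\<^bsub>?W\<^esub> f = \<zero>\<^bsub>?W\<^esub>" using smult[OF f] by blast
  qed (auto simp: add, auto simp: word_algebra_simps word_algebra_carrier_iff algebra_simps)
  show ?thesis
  proof (intro unital_algebra.intro unital_algebra_axioms.intro moduleI cring_scalars group ringI
      monoidI word_algebra_mult_assoc word_algebra_mult_closed)
    show "\<one>\<^bsub>?W\<^esub> \<in> carrier ?W" by (simp add: word_algebra_simps(2) single_word_closed)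
  qed (auto simp: smult,
      auto simp: word_algebra_mult_one word_algebra_simps(2),
      auto simp: word_algebra_simps algebra_simps sum.distrib sum_distrib_left)
qed

text \<open>The combinations \<open>g\<close> in the induction step range over the support of \<open>f\<close> only, so that the
  principle also serves for homogeneous elements.\<close>

lemma word_algebra_induct [consumes 1, case_names zero add]:
  fixes f :: "'a list \<Rightarrow> 'k::real_normed_field"
  assumes f: "f \<in> carrier (word_algebra M)"
    and zero: "P \<zero>\<^bsub>word_algebra M\<^esub>"
    and add: "\<And>g c u. \<lbrakk>g \<in> carrier (word_algebra M); \<And>w. g w \<noteq> 0 \<Longrightarrow> f w \<noteq> 0; f u \<noteq> 0;
      u \<in> lists (carrier M); P g\<rbrakk>
      \<Longrightarrow> P (g \<oplus>\<^bsub>word_algebra M\<^esub> c \<odot>\<^bsub>word_algebra M\<^esub> single_word u)"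
  shows "P f"
proof -
  \<comment> \<open>The claim is proved for the restriction of \<open>f\<close> to any finite part
    \<open>S\<close> of its support, adding one word at a time; the full support gives back
    \<open>f\<close>.\<close>
  have "P (\<lambda>w. if w \<in> S then f w else 0)" if "finite S" "S \<subseteq> {w. f w \<noteq> 0}" for S
    using that
  proof (induction S rule: finite_induct)
    case empty
    then show ?case using zero by (simp add: word_algebra_simps)
  next
    case (insert u S)
    let ?g = "\<lambda>w. if w \<in> S then f w else 0"
    have "P (?g \<oplus>\<^bsub>word_algebra M\<^esub> f u \<odot>\<^bsub>word_algebra M\<^esub> single_word u)"
      using insert f
      by (intro add word_algebra_carrierI[of S]) (auto simp: word_algebra_carrier_iff split: if_splits)
    also have "?g \<oplus>\<^bsub>word_algebra M\<^esub> f u \<odot>\<^bsub>word_algebra M\<^esub> single_word u =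
        (\<lambda>w. if w \<in> insert u S then f w else 0)"
      using insert(2) by (auto simp: word_algebra_simps single_word_def)
    finally show ?case .
  qed
  from this[of "{w. f w \<noteq> 0}"] have "P (\<lambda>w. if f w \<noteq> 0 then f w else 0)"
    using f by (simp add: word_algebra_carrier_iff)
  also have "(\<lambda>w. if f w \<noteq> 0 then f w else 0) = f" by auto
  finally show ?thesis .
qed

lemma word_algebra_homs_eqI:
  fixes M :: "('k::real_normed_field, 'a) module" and A :: "('k, 'b) module"
  assumes "unital_algebra A"
    and g: "g \<in> unital_algebra_homs (word_algebra M) A"
    and h: "h \<in> unital_algebra_homs (word_algebra M) A"
    and eq: "\<And>x. x \<in> carrier M \<Longrightarrow> g (single_word [x]) = h (single_word [x])"
    and f: "f \<in> carrier (word_algebra M)"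
  shows "g f = h f"
proof -
  interpret A: unital_algebra A by fact
  interpret W: unital_algebra "word_algebra M" by (rule unital_algebra_word_algebra)
  note gD = unital_algebra_homsD[OF g] and hD = unital_algebra_homsD[OF h]
  have word: "g (single_word u) = h (single_word u)" if "u \<in> lists (carrier M)" for u
    using that
  proof (induction u)
    case Nil
    then show ?case using gD(4) hD(4) by (simp add: word_algebra_simps)
  next
    case (Cons x u)
    have *: "single_word (x # u) = single_word [x] \<otimes>\<^bsub>word_algebra M\<^esub> single_word u"
      by (simp add: single_word_mult)
    show ?case unfolding * using Cons by (simp add: gD(2) hD(2) single_word_closed eq)
  qed
  have "g \<zero>\<^bsub>word_algebra M\<^esub> = \<zero>\<^bsub>A\<^esub>" "h \<zero>\<^bsub>word_algebra M\<^esub> = \<zero>\<^bsub>A\<^esub>"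
    by (rule unital_algebra_homs_zero[OF _ W.ring_axioms A.ring_axioms], fact)+
  with f show ?thesis
    by (induction f rule: word_algebra_induct) (simp_all add: gD hD single_word_closed word)
qed

section \<open>Evaluation of words in an algebra\<close>

definition word_prod :: "('k::real_normed_field, 'b) module \<Rightarrow> ('a \<Rightarrow> 'b) \<Rightarrow> 'a list \<Rightarrow> 'b"
  where "word_prod A \<phi> w = foldr (\<lambda>x b. \<phi> x \<otimes>\<^bsub>A\<^esub> b) w \<one>\<^bsub>A\<^esub>"

lemma word_prod_simps [simp]:
  "word_prod A \<phi> [] = \<one>\<^bsub>A\<^esub>"
  "word_prod A \<phi> (x # w) = \<phi> x \<otimes>\<^bsub>A\<^esub> word_prod A \<phi> w"
  by (simp_all add: word_prod_def)

definition word_eval :: "('k::real_normed_field, 'b) module \<Rightarrow> ('a \<Rightarrow> 'b) \<Rightarrow> ('a list \<Rightarrow> 'k) \<Rightarrow> 'b"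
  where "word_eval A \<phi> f =
    (\<Oplus>\<^bsub>A\<^esub>w\<in>{w. f w \<noteq> 0}. f w \<odot>\<^bsub>A\<^esub> word_prod A \<phi> w)"

context
  fixes M :: "('k::real_normed_field, 'a) module" and A :: "('k, 'b) module" and \<phi> :: "'a \<Rightarrow> 'b"
  assumes A: "unital_algebra A" and \<phi>: "\<phi> \<in> carrier M \<rightarrow> carrier A"
begin

interpretation A: unital_algebra A by (rule A)
interpretation W: unital_algebra "word_algebra M" by (rule unital_algebra_word_algebra)

lemma word_prod_closed: "w \<in> lists (carrier M) \<Longrightarrow> word_prod A \<phi> w \<in> carrier A"
  using \<phi> by (induction w) auto

lemma word_prod_append:
  "\<lbrakk>u \<in> lists (carrier M); v \<in> lists (carrier M)\<rbrakk>
    \<Longrightarrow> word_prod A \<phi> (u @ v) = word_prod A \<phi> u \<otimes>\<^bsub>A\<^esub> word_prod A \<phi> v"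
proof (induction u)
  case (Cons x u)
  then have "\<phi> x \<in> carrier A" using \<phi> by auto
  with Cons show ?case by (simp add: A.m_assoc word_prod_closed)
qed (simp add: word_prod_closed)

text \<open>Coefficients may cancel, so the support of a sum can be smaller than the union of the
  supports. Summing over a common finite superset makes evaluations of different elements
  comparable.\<close>

lemma word_eval_superset:
  assumes "finite S" "S \<subseteq> lists (carrier M)" "\<And>w. f w \<noteq> 0 \<Longrightarrow> w \<in> S"
  shows "word_eval A \<phi> f = (\<Oplus>\<^bsub>A\<^esub>w\<in>S. f w \<odot>\<^bsub>A\<^esub> word_prod A \<phi> w)"
  unfolding word_eval_def
proof (rule A.add.finprod_mono_neutral_cong_left)
  fix w assume w: "w \<in> S - {w. f w \<noteq> 0}"
  then have "word_prod A \<phi> w \<in> carrier A" using assms(2) by (blast intro: word_prod_closed)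
  then show "f w \<odot>\<^bsub>A\<^esub> word_prod A \<phi> w = \<zero>\<^bsub>A\<^esub>" using w A.smult_l_null by simp
qed (use assms in \<open>auto intro!: A.smult_closed word_prod_closed\<close>)

lemma word_eval_closed: "f \<in> carrier (word_algebra M) \<Longrightarrow> word_eval A \<phi> f \<in> carrier A"
  unfolding word_eval_def word_algebra_carrier_iff
  by (intro A.finsum_closed) (auto intro!: A.smult_closed word_prod_closed)

lemma word_eval_add:
  assumes "f \<in> carrier (word_algebra M)" "g \<in> carrier (word_algebra M)"
  shows "word_eval A \<phi> (f \<oplus>\<^bsub>word_algebra M\<^esub> g) = word_eval A \<phi> f \<oplus>\<^bsub>A\<^esub> word_eval A \<phi> g"
proof -
  define S where "S = {w. f w \<noteq> 0} \<union> {w. g w \<noteq> 0}"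
  have S: "finite S" "S \<subseteq> lists (carrier M)"
    using assms by (auto simp: S_def word_algebra_carrier_iff)
  have cl: "f w \<odot>\<^bsub>A\<^esub> word_prod A \<phi> w \<in> carrier A" "g w \<odot>\<^bsub>A\<^esub> word_prod A \<phi> w \<in> carrier A"
    if "w \<in> S" for w using that S by (auto intro!: A.smult_closed word_prod_closed)
  have "word_eval A \<phi> (f \<oplus>\<^bsub>word_algebra M\<^esub> g) = (\<Oplus>\<^bsub>A\<^esub>w\<in>S. (f w + g w) \<odot>\<^bsub>A\<^esub> word_prod A \<phi> w)"
    using S by (subst word_eval_superset[of S]) (auto simp: S_def word_algebra_simps)
  also have "\<dots> = (\<Oplus>\<^bsub>A\<^esub>w\<in>S. f w \<odot>\<^bsub>A\<^esub> word_prod A \<phi> w \<oplus>\<^bsub>A\<^esub> g w \<odot>\<^bsub>A\<^esub> word_prod A \<phi> w)"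
  proof (rule A.finsum_cong')
    fix w assume "w \<in> S"
    then have "word_prod A \<phi> w \<in> carrier A" using S by (auto intro!: word_prod_closed)
    from A.smult_l_distr[OF _ _ this, of "f w" "g w"]
    show "(f w + g w) \<odot>\<^bsub>A\<^esub> word_prod A \<phi> w = f w \<odot>\<^bsub>A\<^esub> word_prod A \<phi> w \<oplus>\<^bsub>A\<^esub> g w \<odot>\<^bsub>A\<^esub> word_prod A \<phi> w"
      by simp
  qed (auto simp: cl)
  also have "\<dots> = (\<Oplus>\<^bsub>A\<^esub>w\<in>S. f w \<odot>\<^bsub>A\<^esub> word_prod A \<phi> w) \<oplus>\<^bsub>A\<^esub> (\<Oplus>\<^bsub>A\<^esub>w\<in>S. g w \<odot>\<^bsub>A\<^esub> word_prod A \<phi> w)"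
    by (rule A.finsum_addf) (auto simp: cl)
  also have "(\<Oplus>\<^bsub>A\<^esub>w\<in>S. f w \<odot>\<^bsub>A\<^esub> word_prod A \<phi> w) = word_eval A \<phi> f"
    by (rule word_eval_superset[OF S, symmetric]) (auto simp: S_def)
  also have "(\<Oplus>\<^bsub>A\<^esub>w\<in>S. g w \<odot>\<^bsub>A\<^esub> word_prod A \<phi> w) = word_eval A \<phi> g"
    by (rule word_eval_superset[OF S, symmetric]) (auto simp: S_def)
  finally show ?thesis .
qed

lemma word_eval_smult:
  assumes "f \<in> carrier (word_algebra M)"
  shows "word_eval A \<phi> (c \<odot>\<^bsub>word_algebra M\<^esub> f) = c \<odot>\<^bsub>A\<^esub> word_eval A \<phi> f"
proof -
  define S where "S = {w. f w \<noteq> 0}"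
  have S: "finite S" "S \<subseteq> lists (carrier M)"
    using assms by (auto simp: S_def word_algebra_carrier_iff)
  have cl: "f w \<odot>\<^bsub>A\<^esub> word_prod A \<phi> w \<in> carrier A" "word_prod A \<phi> w \<in> carrier A"
    if "w \<in> S" for w using that S by (auto intro!: A.smult_closed word_prod_closed)
  have "word_eval A \<phi> (c \<odot>\<^bsub>word_algebra M\<^esub> f) = (\<Oplus>\<^bsub>A\<^esub>w\<in>S. (c * f w) \<odot>\<^bsub>A\<^esub> word_prod A \<phi> w)"
    using S by (subst word_eval_superset[of S]) (auto simp: S_def word_algebra_simps)
  also have "\<dots> = (\<Oplus>\<^bsub>A\<^esub>w\<in>S. c \<odot>\<^bsub>A\<^esub> (f w \<odot>\<^bsub>A\<^esub> word_prod A \<phi> w))"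
  proof (rule A.finsum_cong')
    fix w assume "w \<in> S"
    from A.smult_assoc1[OF _ _ cl(2)[OF this], of c "f w"]
    show "(c * f w) \<odot>\<^bsub>A\<^esub> word_prod A \<phi> w = c \<odot>\<^bsub>A\<^esub> (f w \<odot>\<^bsub>A\<^esub> word_prod A \<phi> w)" by simp
  qed (auto simp: cl)
  also have "\<dots> = c \<odot>\<^bsub>A\<^esub> (\<Oplus>\<^bsub>A\<^esub>w\<in>S. f w \<odot>\<^bsub>A\<^esub> word_prod A \<phi> w)"
    by (rule A.finsum_smult_ldistr[symmetric]) (auto simp: S cl)
  also have "(\<Oplus>\<^bsub>A\<^esub>w\<in>S. f w \<odot>\<^bsub>A\<^esub> word_prod A \<phi> w) = word_eval A \<phi> f"
    by (simp add: S_def word_eval_def)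
  finally show ?thesis .
qed

lemma word_eval_single_word:
  assumes "u \<in> lists (carrier M)"
  shows "word_eval A \<phi> (single_word u) = word_prod A \<phi> u"
proof -
  have "word_eval A \<phi> (single_word u) = (\<Oplus>\<^bsub>A\<^esub>w\<in>{u}. single_word u w \<odot>\<^bsub>A\<^esub> word_prod A \<phi> w)"
    using assms by (intro word_eval_superset) (auto simp: single_word_def split: if_splits)
  also have "\<dots> = word_prod A \<phi> u"
    using word_prod_closed[OF assms] A.smult_one[OF word_prod_closed[OF assms]]
    by (simp add: single_word_def)
  finally show ?thesis .
qed

lemma word_eval_zero: "word_eval A \<phi> \<zero>\<^bsub>word_algebra M\<^esub> = \<zero>\<^bsub>A\<^esub>"
  by (simp add: word_eval_def word_algebra_simps)

text \<open>Both sides are bilinear, which reduces the claim to two words, where it is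
  \<open>word_prod_append\<close>. Fact \<open>1\<close> treats a word on the left by induction on
  \<open>g\<close>; the induction on \<open>f\<close> follows. The convolution sum never has to be
  reindexed.\<close>

lemma word_eval_mult:
  assumes f: "f \<in> carrier (word_algebra M)" and g: "g \<in> carrier (word_algebra M)"
  shows "word_eval A \<phi> (f \<otimes>\<^bsub>word_algebra M\<^esub> g) = word_eval A \<phi> f \<otimes>\<^bsub>A\<^esub> word_eval A \<phi> g"
proof -
  have 1: "word_eval A \<phi> (single_word u \<otimes>\<^bsub>word_algebra M\<^esub> g) = word_prod A \<phi> u \<otimes>\<^bsub>A\<^esub> word_eval A \<phi> g"
    if u: "u \<in> lists (carrier M)" for u
    using g
  proof (induction g rule: word_algebra_induct)
    case zero
    show ?case using u by (simp add: single_word_closed word_eval_zero word_prod_closed)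
  next
    case (add h c v)
    note cl = single_word_closed[OF u] single_word_closed[OF add(4)] add(1)
      word_prod_closed[OF u] word_prod_closed[OF add(4)]
    have uv: "u @ v \<in> lists (carrier M)" using u add(4) by simp
    show ?case
      using cl uv add(4,5) u
      by (simp add: W.r_distr A.r_distr word_eval_add word_eval_smult word_eval_closed single_word_closed
          W.mult_smult_right A.mult_smult_right single_word_mult word_eval_single_word word_prod_append)
  qed
  show ?thesis
    using f
  proof (induction f rule: word_algebra_induct)
    case zero
    show ?case using g by (simp add: word_eval_zero word_eval_closed)
  next
    case (add h c u)
    note cl = single_word_closed[OF add(4)] add(1) word_prod_closed[OF add(4)] g word_eval_closed[OF g]
    show ?case
      using cl add(4,5)
      by (simp add: W.l_distr A.l_distr word_eval_add word_eval_smult word_eval_closed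
          W.mult_smult_left A.mult_smult_left 1 word_eval_single_word)
  qed
qed

lemma word_eval_hom: "word_eval A \<phi> \<in> unital_algebra_homs (word_algebra M) A"
  by (rule unital_algebra_homsI)
    (simp_all add: word_eval_closed word_eval_mult word_eval_add word_eval_smult
      word_algebra_simps(2) word_eval_single_word)

end

subsection \<open>Tensor powers\<close>

lemma free_tuples_carrier_iff:
  "f \<in> carrier (free_tuples M n) \<longleftrightarrow>
    f \<in> carrier (word_algebra M) \<and> (\<forall>w. f w \<noteq> 0 \<longrightarrow> length w = n)"
  by (simp add: free_tuples_def)

lemma free_tuples_simps:
  "\<zero>\<^bsub>free_tuples M n\<^esub> = (\<lambda>w. 0)"
  "f \<oplus>\<^bsub>free_tuples M n\<^esub> g = (\<lambda>w. f w + g w)"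
  "c \<odot>\<^bsub>free_tuples M n\<^esub> f = (\<lambda>w. c * f w)"
  by (simp_all add: free_tuples_def word_algebra_simps)

text \<open>The operations are those of the word algebra on a smaller carrier, so it suffices that
  this carrier is a submodule there.\<close>

lemma module_free_tuples: "module scalars (free_tuples M n)"
proof -
  interpret W: unital_algebra "word_algebra M" by (rule unital_algebra_word_algebra)
  have "submodule (carrier (free_tuples M n)) scalars (word_algebra M)"
  proof (rule submodule_scalarsI[OF W.module_axioms])
    fix f g assume "f \<in> carrier (free_tuples M n)" "g \<in> carrier (free_tuples M n)"
    then show "f \<oplus>\<^bsub>word_algebra M\<^esub> g \<in> carrier (free_tuples M n)"
      using W.a_closed[of f g] by (auto simp: free_tuples_carrier_iff word_algebra_simps) force
  next
    fix c f assume "f \<in> carrier (free_tuples M n)"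
    then show "c \<odot>\<^bsub>word_algebra M\<^esub> f \<in> carrier (free_tuples M n)"
      using W.smult_closed[of c f] by (auto simp: free_tuples_carrier_iff word_algebra_simps)
  next
    show "\<zero>\<^bsub>word_algebra M\<^esub> \<in> carrier (free_tuples M n)"
      using W.zero_closed by (auto simp: free_tuples_carrier_iff word_algebra_simps)
  qed (auto simp: free_tuples_carrier_iff)
  from submodule.submodule_is_module[OF this W.module_axioms] show ?thesis
    by (simp add: free_tuples_def)
qed

lemma free_tuples_minus:
  assumes "f \<in> carrier (free_tuples M n)" "g \<in> carrier (free_tuples M n)"
  shows "f \<ominus>\<^bsub>free_tuples M n\<^esub> g = (\<lambda>w. f w - g w)"
proof -
  interpret F: module scalars "free_tuples M n" by (rule module_free_tuples)
  \<comment> \<open>The additive inverse of the record is the one found inside its carrier, so the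
    pointwise negative has to be located there first.\<close>
  have "(\<lambda>w. - g w) \<in> carrier (free_tuples M n)"
    using F.smult_closed[of "-1" g] assms(2) by (simp add: free_tuples_simps)
  then have "\<ominus>\<^bsub>free_tuples M n\<^esub> g = (\<lambda>w. - g w)"
    using assms(2) by (intro F.minus_equality) (auto simp: free_tuples_simps)
  then show ?thesis by (simp add: a_minus_def free_tuples_simps)
qed

lemma free_tuples_finsum:
  assumes "finite S" "\<And>i. i \<in> S \<Longrightarrow> f i \<in> carrier (free_tuples M n)"
  shows "(\<Oplus>\<^bsub>free_tuples M n\<^esub>i\<in>S. f i) = (\<lambda>w. \<Sum>i\<in>S. f i w)"
  using assms
proof (induction S rule: finite_induct)
  interpret F: module scalars "free_tuples M n" by (rule module_free_tuples)
  {
    case empty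
    show ?case by (simp add: free_tuples_simps)
  next
    case (insert j S)
    have "(\<Oplus>\<^bsub>free_tuples M n\<^esub>i\<in>insert j S. f i) =
        f j \<oplus>\<^bsub>free_tuples M n\<^esub> (\<Oplus>\<^bsub>free_tuples M n\<^esub>i\<in>S. f i)"
      using insert by (intro F.finsum_insert) auto
    then show ?case using insert by (simp add: free_tuples_simps)
  }
qed

lemma free_tuples_mult_closed:
  assumes "f \<in> carrier (free_tuples M i)" "g \<in> carrier (free_tuples M j)"
  shows "f \<otimes>\<^bsub>word_algebra M\<^esub> g \<in> carrier (free_tuples M (i + j))"
  unfolding free_tuples_carrier_iff
proof (intro conjI allI impI)
  show "f \<otimes>\<^bsub>word_algebra M\<^esub> g \<in> carrier (word_algebra M)"
    using assms by (intro word_algebra_mult_closed) (auto simp: free_tuples_carrier_iff)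
  fix w assume "(f \<otimes>\<^bsub>word_algebra M\<^esub> g) w \<noteq> 0"
  then obtain k where k: "k \<le> length w" "f (take k w) * g (drop k w) \<noteq> 0"
    by (auto simp: word_algebra_simps elim: sum.not_neutral_contains_not_neutral)
  then have "length (take k w) = i" "length (drop k w) = j"
    using assms unfolding free_tuples_carrier_iff by auto
  then show "length w = i + j" using k by auto
qed

section \<open>The multilinear relations absorb multiplication from both sides\<close>

context
  fixes M :: "('k::real_normed_field, 'a) module"
  assumes M: "module scalars M"
begin

interpretation M: module scalars M by (rule M)

text \<open>Linearity in the slot between \<open>u\<close> and \<open>v\<close>: c = d = 1 gives
  additivity and d = 0 gives compatibility with scalars.\<close>

private abbreviation relator :: "'k \<Rightarrow> 'k \<Rightarrow> 'a \<Rightarrow> 'a \<Rightarrow> 'a list \<Rightarrow> 'a list \<Rightarrow> 'a list \<Rightarrow> 'k"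
  where "relator c d x y u v \<equiv> (\<lambda>w. single_word (u @ [c \<odot>\<^bsub>M\<^esub> x \<oplus>\<^bsub>M\<^esub> d \<odot>\<^bsub>M\<^esub> y] @ v) w
        - c * single_word (u @ [x] @ v) w - d * single_word (u @ [y] @ v) w)"

lemma relator_closed:
  assumes "x \<in> carrier M" "y \<in> carrier M" "u \<in> lists (carrier M)" "v \<in> lists (carrier M)"
    "length u + 1 + length v = n"
  shows "relator c d x y u v \<in> carrier (free_tuples M n)"
  unfolding free_tuples_carrier_iff
proof (intro conjI word_algebra_carrierI[of "{u @ [c \<odot>\<^bsub>M\<^esub> x \<oplus>\<^bsub>M\<^esub> d \<odot>\<^bsub>M\<^esub> y] @ v, u @ [x] @ v, u @ [y] @ v}"])
  show "{u @ [c \<odot>\<^bsub>M\<^esub> x \<oplus>\<^bsub>M\<^esub> d \<odot>\<^bsub>M\<^esub> y] @ v, u @ [x] @ v, u @ [y] @ v} \<subseteq> lists (carrier M)"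
    using assms by auto
  show "\<forall>w. relator c d x y u v w \<noteq> 0 \<longrightarrow> length w = n"
    using assms(5) by (auto simp: single_word_def split: if_splits)
qed (auto simp: single_word_def split: if_splits)

lemma multilinear_relations_submodule:
  "submodule (multilinear_relations M n) scalars (free_tuples M n)"
  unfolding multilinear_relations_def
  by (rule submodule_module_span[OF module_free_tuples]) (use relator_closed in blast)

lemma relator_in_multilinear_relations:
  assumes "x \<in> carrier M" "y \<in> carrier M" "u \<in> lists (carrier M)" "v \<in> lists (carrier M)"
    "length u + 1 + length v = n"
  shows "relator c d x y u v \<in> multilinear_relations M n"
  unfolding multilinear_relations_def
  by (rule subsetD[OF module_span_superset]) (use assms in blast)

text \<open>The span is the least submodule containing the relators, so it lies in the set of those
  \<open>f\<close> in \<open>free_tuples\<close> with \<open>P f\<close> once that set is a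
  submodule. For this reason the closure cases are stated for elements of \<open>free_tuples\<close>
  instead of relations.\<close>

lemma multilinear_relations_induct [consumes 1, case_names relator zero add smult]:
  assumes "f \<in> multilinear_relations M n"
    and "\<And>c d x y u v. \<lbrakk>x \<in> carrier M; y \<in> carrier M; u \<in> lists (carrier M); v \<in> lists (carrier M);
      length u + 1 + length v = n\<rbrakk> \<Longrightarrow> P (relator c d x y u v)"
    and "P (\<lambda>w. 0)"
    and "\<And>f g. \<lbrakk>f \<in> carrier (free_tuples M n); P f; g \<in> carrier (free_tuples M n); P g\<rbrakk>
      \<Longrightarrow> P (\<lambda>w. f w + g w)"
    and "\<And>c f. \<lbrakk>f \<in> carrier (free_tuples M n); P f\<rbrakk> \<Longrightarrow> P (\<lambda>w. c * f w)"
  shows "P f"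
proof -
  interpret F: module scalars "free_tuples M n" by (rule module_free_tuples)
  have sub: "submodule {f \<in> carrier (free_tuples M n). P f} scalars (free_tuples M n)"
  proof (rule submodule_scalarsI[OF module_free_tuples])
    show "\<zero>\<^bsub>free_tuples M n\<^esub> \<in> {f \<in> carrier (free_tuples M n). P f}"
      using assms(3) F.zero_closed by (simp add: free_tuples_simps)
  next
    fix f g assume "f \<in> {f \<in> carrier (free_tuples M n). P f}" "g \<in> {f \<in> carrier (free_tuples M n). P f}"
    then show "f \<oplus>\<^bsub>free_tuples M n\<^esub> g \<in> {f \<in> carrier (free_tuples M n). P f}"
      using assms(4)[of f g] F.a_closed[of f g] by (simp add: free_tuples_simps)
  next
    fix c f assume "f \<in> {f \<in> carrier (free_tuples M n). P f}"
    then show "c \<odot>\<^bsub>free_tuples M n\<^esub> f \<in> {f \<in> carrier (free_tuples M n). P f}"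
      using assms(5)[of f c] F.smult_closed[of c f] by (simp add: free_tuples_simps)
  qed auto
  have "multilinear_relations M n \<subseteq> {f \<in> carrier (free_tuples M n). P f}"
    unfolding multilinear_relations_def
    by (rule module_span_minimal[OF sub]) (clarify, intro conjI assms(2) relator_closed, auto)
  then show ?thesis using assms(1) by blast
qed

lemma multilinear_relations_closed:
  "(\<lambda>w. 0) \<in> multilinear_relations M n"
  "\<lbrakk>f \<in> multilinear_relations M n; g \<in> multilinear_relations M n\<rbrakk>
    \<Longrightarrow> (\<lambda>w. f w + g w) \<in> multilinear_relations M n"
  "f \<in> multilinear_relations M n \<Longrightarrow> (\<lambda>w. c * f w) \<in> multilinear_relations M n"
  "f \<in> multilinear_relations M n \<Longrightarrow> f \<in> carrier (free_tuples M n)"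
proof -
  note sub = multilinear_relations_submodule[of n]
  interpret F: module scalars "free_tuples M n" by (rule module_free_tuples)
  interpret R: abelian_subgroup "multilinear_relations M n" "free_tuples M n"
    by (rule abelian_subgroup_submodule[OF module_free_tuples sub])
  show "(\<lambda>w. 0) \<in> multilinear_relations M n"
    using R.zero_closed by (simp add: free_tuples_simps)
  show "\<lbrakk>f \<in> multilinear_relations M n; g \<in> multilinear_relations M n\<rbrakk>
    \<Longrightarrow> (\<lambda>w. f w + g w) \<in> multilinear_relations M n"
    using R.a_closed[of f g] by (simp add: free_tuples_simps)
  show "f \<in> multilinear_relations M n \<Longrightarrow> (\<lambda>w. c * f w) \<in> multilinear_relations M n"
    using submodule.smult_closed[OF sub, of c f] by (simp add: free_tuples_simps)
  show "f \<in> multilinear_relations M n \<Longrightarrow> f \<in> carrier (free_tuples M n)"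
    using R.a_subset by blast
qed

text \<open>Multiplication by a word lengthens the context to the right of the slot and leaves the
  slot itself alone. This and its mirror image below are why the relations behave like an
  ideal.\<close>

lemma relator_mult_single_word:
  "relator c d x y u v \<otimes>\<^bsub>word_algebra M\<^esub> single_word w = relator c d x y u (v @ w)"
proof -
  have "relator c d x y u v \<otimes>\<^bsub>word_algebra M\<^esub> h = (\<lambda>w.
      (single_word (u @ [c \<odot>\<^bsub>M\<^esub> x \<oplus>\<^bsub>M\<^esub> d \<odot>\<^bsub>M\<^esub> y] @ v) \<otimes>\<^bsub>word_algebra M\<^esub> h) w
      - c * (single_word (u @ [x] @ v) \<otimes>\<^bsub>word_algebra M\<^esub> h) w
      - d * (single_word (u @ [y] @ v) \<otimes>\<^bsub>word_algebra M\<^esub> h) w)" for h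
    by (simp add: word_algebra_simps left_diff_distrib sum_subtractf sum_distrib_left mult.assoc)
  then show ?thesis by (simp add: single_word_mult)
qed

lemma single_word_mult_relator:
  "single_word w \<otimes>\<^bsub>word_algebra M\<^esub> relator c d x y u v = relator c d x y (w @ u) v"
proof -
  have "h \<otimes>\<^bsub>word_algebra M\<^esub> relator c d x y u v = (\<lambda>w.
      (h \<otimes>\<^bsub>word_algebra M\<^esub> single_word (u @ [c \<odot>\<^bsub>M\<^esub> x \<oplus>\<^bsub>M\<^esub> d \<odot>\<^bsub>M\<^esub> y] @ v)) w
      - c * (h \<otimes>\<^bsub>word_algebra M\<^esub> single_word (u @ [x] @ v)) w
      - d * (h \<otimes>\<^bsub>word_algebra M\<^esub> single_word (u @ [y] @ v)) w)" for h
    by (simp add: word_algebra_simps right_diff_distrib sum_subtractf sum_distrib_left mult.left_commute)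
  then show ?thesis by (simp add: single_word_mult)
qed

text \<open>For a relator times a word the claim is \<open>relator_mult_single_word\<close>;
  linearity extends it in \<open>f\<close> (fact \<open>single\<close>) and then in
  \<open>g\<close>.\<close>

lemma multilinear_relations_mult_right:
  assumes f: "f \<in> multilinear_relations M i" and g: "g \<in> carrier (free_tuples M j)"
  shows "f \<otimes>\<^bsub>word_algebra M\<^esub> g \<in> multilinear_relations M (i + j)"
proof -
  have single: "f \<otimes>\<^bsub>word_algebra M\<^esub> single_word v \<in> multilinear_relations M (i + j)"
    if v: "v \<in> lists (carrier M)" "length v = j" for v
    using f
  proof (induction f rule: multilinear_relations_induct)
    case (relator c d x y u v')
    then show ?case unfolding relator_mult_single_word
      by (intro relator_in_multilinear_relations) (use v in auto)
  next
    case zero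
    then show ?case by (simp add: word_algebra_simps multilinear_relations_closed)
  next
    case (add f g)
    have "(\<lambda>w. f w + g w) \<otimes>\<^bsub>word_algebra M\<^esub> single_word v =
        (\<lambda>w. (f \<otimes>\<^bsub>word_algebra M\<^esub> single_word v) w + (g \<otimes>\<^bsub>word_algebra M\<^esub> single_word v) w)"
      by (simp add: word_algebra_simps distrib_right sum.distrib)
    then show ?case using multilinear_relations_closed(2)[OF add.IH] by simp
  next
    case (smult c f)
    have "(\<lambda>w. c * f w) \<otimes>\<^bsub>word_algebra M\<^esub> single_word v =
        (\<lambda>w. c * (f \<otimes>\<^bsub>word_algebra M\<^esub> single_word v) w)"
      by (simp add: word_algebra_simps sum_distrib_left mult.assoc)
    then show ?case using multilinear_relations_closed(3)[OF smult.IH] by simp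
  qed
  \<comment> \<open>The induction on \<open>g\<close> below adds only words from the support of
    \<open>g\<close>, so each has length \<open>j\<close>, as \<open>single\<close> demands.\<close>
  have len: "length w = j" if "g w \<noteq> 0" for w using g that by (auto simp: free_tuples_carrier_iff)
  have "g \<in> carrier (word_algebra M)" using g by (simp add: free_tuples_carrier_iff)
  then show ?thesis
  proof (induction g rule: word_algebra_induct)
    case zero
    show ?case using multilinear_relations_closed(1) by (simp add: word_algebra_simps)
  next
    case (add h c v)
    have "f \<otimes>\<^bsub>word_algebra M\<^esub> (h \<oplus>\<^bsub>word_algebra M\<^esub> c \<odot>\<^bsub>word_algebra M\<^esub> single_word v) =
        (\<lambda>w. (f \<otimes>\<^bsub>word_algebra M\<^esub> h) w + c * (f \<otimes>\<^bsub>word_algebra M\<^esub> single_word v) w)"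
      by (simp add: word_algebra_simps distrib_left sum.distrib sum_distrib_left mult.left_commute)
    then show ?case
      using multilinear_relations_closed(2)[OF add(5) multilinear_relations_closed(3)[OF single]]
        add(4) len[OF add(3)] by simp
  qed
qed

text \<open>Mirror image of the previous argument: here words are absorbed into the left context of
  the slot.\<close>

lemma multilinear_relations_mult_left:
  assumes f: "f \<in> multilinear_relations M i" and g: "g \<in> carrier (free_tuples M j)"
  shows "g \<otimes>\<^bsub>word_algebra M\<^esub> f \<in> multilinear_relations M (j + i)"
proof -
  have single: "single_word v \<otimes>\<^bsub>word_algebra M\<^esub> f \<in> multilinear_relations M (j + i)"
    if v: "v \<in> lists (carrier M)" "length v = j" for v
    using f
  proof (induction f rule: multilinear_relations_induct)
    case (relator c d x y u v')
    then show ?case unfolding single_word_mult_relator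
      by (intro relator_in_multilinear_relations) (use v in auto)
  next
    case zero
    then show ?case by (simp add: word_algebra_simps multilinear_relations_closed)
  next
    case (add f g)
    have "single_word v \<otimes>\<^bsub>word_algebra M\<^esub> (\<lambda>w. f w + g w) =
        (\<lambda>w. (single_word v \<otimes>\<^bsub>word_algebra M\<^esub> f) w + (single_word v \<otimes>\<^bsub>word_algebra M\<^esub> g) w)"
      by (simp add: word_algebra_simps distrib_left sum.distrib)
    then show ?case using multilinear_relations_closed(2)[OF add.IH] by simp
  next
    case (smult c f)
    have "single_word v \<otimes>\<^bsub>word_algebra M\<^esub> (\<lambda>w. c * f w) =
        (\<lambda>w. c * (single_word v \<otimes>\<^bsub>word_algebra M\<^esub> f) w)"
      by (simp add: word_algebra_simps sum_distrib_left mult.left_commute)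
    then show ?case using multilinear_relations_closed(3)[OF smult.IH] by simp
  qed
  have len: "length w = j" if "g w \<noteq> 0" for w using g that by (auto simp: free_tuples_carrier_iff)
  have "g \<in> carrier (word_algebra M)" using g by (simp add: free_tuples_carrier_iff)
  then show ?thesis
  proof (induction g rule: word_algebra_induct)
    case zero
    show ?case using multilinear_relations_closed(1) by (simp add: word_algebra_simps)
  next
    case (add h c v)
    have "(h \<oplus>\<^bsub>word_algebra M\<^esub> c \<odot>\<^bsub>word_algebra M\<^esub> single_word v) \<otimes>\<^bsub>word_algebra M\<^esub> f =
        (\<lambda>w. (h \<otimes>\<^bsub>word_algebra M\<^esub> f) w + c * (single_word v \<otimes>\<^bsub>word_algebra M\<^esub> f) w)"
      by (simp add: word_algebra_simps distrib_right sum.distrib sum_distrib_left mult.assoc)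
    then show ?case
      using multilinear_relations_closed(2)[OF add(5) multilinear_relations_closed(3)[OF single]]
        add(4) len[OF add(3)] by simp
  qed
qed

lemma multilinear_coset_eq_iff:
  assumes "f \<in> carrier (free_tuples M n)" "g \<in> carrier (free_tuples M n)"
  shows "multilinear_relations M n +>\<^bsub>free_tuples M n\<^esub> f = multilinear_relations M n +>\<^bsub>free_tuples M n\<^esub> g
    \<longleftrightarrow> (\<lambda>w. f w - g w) \<in> multilinear_relations M n"
  using coset_eq_iff[OF module_free_tuples multilinear_relations_submodule assms]
  by (simp add: free_tuples_minus[OF assms])

text \<open>For other representatives f' and g', f' g' - f g = (f' - f) g' + f (g' - g). The first
  summand is a relation by absorption from the right, the second by absorption from the left, so the
  union defining \<open>tensor_concat\<close> is over copies of one coset.\<close>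

lemma tensor_concat_cosets:
  assumes f: "f \<in> carrier (free_tuples M i)" and g: "g \<in> carrier (free_tuples M j)"
  shows "tensor_concat M (i + j) (multilinear_relations M i +>\<^bsub>free_tuples M i\<^esub> f)
      (multilinear_relations M j +>\<^bsub>free_tuples M j\<^esub> g) =
    multilinear_relations M (i + j) +>\<^bsub>free_tuples M (i + j)\<^esub> (f \<otimes>\<^bsub>word_algebra M\<^esub> g)"
proof -
  interpret Ri: abelian_subgroup "multilinear_relations M i" "free_tuples M i"
    by (rule abelian_subgroup_submodule[OF module_free_tuples multilinear_relations_submodule])
  interpret Rj: abelian_subgroup "multilinear_relations M j" "free_tuples M j"
    by (rule abelian_subgroup_submodule[OF module_free_tuples multilinear_relations_submodule])
  have "multilinear_relations M (i + j) +>\<^bsub>free_tuples M (i + j)\<^esub> (f' \<otimes>\<^bsub>word_algebra M\<^esub> g') =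
      multilinear_relations M (i + j) +>\<^bsub>free_tuples M (i + j)\<^esub> (f \<otimes>\<^bsub>word_algebra M\<^esub> g)"
    if f': "f' \<in> multilinear_relations M i +>\<^bsub>free_tuples M i\<^esub> f"
      and g': "g' \<in> multilinear_relations M j +>\<^bsub>free_tuples M j\<^esub> g" for f' g'
  proof -
    have cl: "f' \<in> carrier (free_tuples M i)" "g' \<in> carrier (free_tuples M j)"
      using Ri.a_elemrcos_carrier[OF f f'] Rj.a_elemrcos_carrier[OF g g'] by auto
    have "(\<lambda>w. f' w - f w) \<in> multilinear_relations M i"
      using Ri.a_rcos_module_imp[OF f f'] free_tuples_minus[OF cl(1) f] by (simp add: a_minus_def)
    then have 1: "(\<lambda>w. f' w - f w) \<otimes>\<^bsub>word_algebra M\<^esub> g' \<in> multilinear_relations M (i + j)"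
      using cl(2) by (rule multilinear_relations_mult_right)
    have "(\<lambda>w. g' w - g w) \<in> multilinear_relations M j"
      using Rj.a_rcos_module_imp[OF g g'] free_tuples_minus[OF cl(2) g] by (simp add: a_minus_def)
    then have 2: "f \<otimes>\<^bsub>word_algebra M\<^esub> (\<lambda>w. g' w - g w) \<in> multilinear_relations M (i + j)"
      using f by (rule multilinear_relations_mult_left)
    have "(\<lambda>w. (f' \<otimes>\<^bsub>word_algebra M\<^esub> g') w - (f \<otimes>\<^bsub>word_algebra M\<^esub> g) w) =
        (\<lambda>w. ((\<lambda>w. f' w - f w) \<otimes>\<^bsub>word_algebra M\<^esub> g') w + (f \<otimes>\<^bsub>word_algebra M\<^esub> (\<lambda>w. g' w - g w)) w)"
      by (simp add: word_algebra_simps sum_subtractf left_diff_distrib right_diff_distrib)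
    then show ?thesis
      using multilinear_relations_closed(2)[OF 1 2] cl f g
      by (simp add: multilinear_coset_eq_iff free_tuples_mult_closed)
  qed
  moreover have "f \<in> multilinear_relations M i +>\<^bsub>free_tuples M i\<^esub> f"
    "g \<in> multilinear_relations M j +>\<^bsub>free_tuples M j\<^esub> g"
    using f g by (auto intro: Ri.a_rcos_self Rj.a_rcos_self)
  ultimately show ?thesis unfolding tensor_concat_def by blast
qed

end

subsection \<open>The tensor algebra as a quotient of the algebra of words\<close>

definition degree_part :: "nat \<Rightarrow> ('a list \<Rightarrow> 'k::real_normed_field) \<Rightarrow> 'a list \<Rightarrow> 'k"
  where "degree_part n f = (\<lambda>w. if length w = n then f w else 0)"

definition word_class ::
    "('k::real_normed_field, 'a) module \<Rightarrow> ('a list \<Rightarrow> 'k) \<Rightarrow> nat \<Rightarrow> ('a list \<Rightarrow> 'k) set"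
  where "word_class M f = (\<lambda>n. multilinear_relations M n +>\<^bsub>free_tuples M n\<^esub> degree_part n f)"

lemma tensor_algebra_simps:
  "s \<otimes>\<^bsub>tensor_algebra M\<^esub> t =
    (\<lambda>n. \<Oplus>\<^bsub>tensor_power M n\<^esub>i\<in>{..n}. tensor_concat M n (s i) (t (n - i)))"
  "\<one>\<^bsub>tensor_algebra M\<^esub> = pure_tensor M []"
  "\<zero>\<^bsub>tensor_algebra M\<^esub> = (\<lambda>n. \<zero>\<^bsub>tensor_power M n\<^esub>)"
  "s \<oplus>\<^bsub>tensor_algebra M\<^esub> t = (\<lambda>n. s n \<oplus>\<^bsub>tensor_power M n\<^esub> t n)"
  "c \<odot>\<^bsub>tensor_algebra M\<^esub> t = (\<lambda>n. c \<odot>\<^bsub>tensor_power M n\<^esub> t n)"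
  by (simp_all add: tensor_algebra_def)

lemma tensor_algebra_carrier_iff:
  "t \<in> carrier (tensor_algebra M) \<longleftrightarrow>
    (\<forall>n. t n \<in> carrier (tensor_power M n)) \<and> finite {n. t n \<noteq> multilinear_relations M n}"
  by (simp add: tensor_algebra_def tensor_power_def quot_module_simps)

lemma degree_part_closed:
  assumes "f \<in> carrier (word_algebra M)"
  shows "degree_part n f \<in> carrier (free_tuples M n)"
  unfolding free_tuples_carrier_iff
proof
  show "degree_part n f \<in> carrier (word_algebra M)"
    by (rule word_algebra_carrierI[of "{w. f w \<noteq> 0}"])
      (use assms in \<open>auto simp: word_algebra_carrier_iff degree_part_def split: if_splits\<close>)
qed (simp add: degree_part_def)

context
  fixes M :: "('k::real_normed_field, 'a) module"
  assumes M: "module scalars M"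
begin

interpretation W: unital_algebra "word_algebra M" by (rule unital_algebra_word_algebra)

lemma multilinear_coset_zero: "multilinear_relations M n +>\<^bsub>free_tuples M n\<^esub> (\<lambda>w. 0) = multilinear_relations M n"
  using coset_zero[OF module_free_tuples multilinear_relations_submodule[OF M], of n]
  by (simp add: free_tuples_simps)

lemma word_class_closed:
  assumes f: "f \<in> carrier (word_algebra M)"
  shows "word_class M f \<in> carrier (tensor_algebra M)"
  unfolding tensor_algebra_carrier_iff
proof (intro conjI allI)
  fix n show "word_class M f n \<in> carrier (tensor_power M n)"
    by (simp add: word_class_def tensor_power_def quot_module_simps degree_part_closed[OF f])
next
  \<comment> \<open>A degree in which \<open>f\<close> has no word carries the zero class. The
    lengths of the words in the finite support thus bound the nonzero degrees.\<close>
  have "n \<in> length ` {w. f w \<noteq> 0}" if "word_class M f n \<noteq> multilinear_relations M n" for n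
  proof (rule ccontr)
    assume "n \<notin> length ` {w. f w \<noteq> 0}"
    then have "degree_part n f = (\<lambda>w. 0)" by (force simp: degree_part_def)
    with that show False by (simp add: word_class_def multilinear_coset_zero)
  qed
  then have "{n. word_class M f n \<noteq> multilinear_relations M n} \<subseteq> length ` {w. f w \<noteq> 0}" by blast
  moreover have "finite (length ` {w. f w \<noteq> 0})" using f by (simp add: word_algebra_carrier_iff)
  ultimately show "finite {n. word_class M f n \<noteq> multilinear_relations M n}" by (rule finite_subset)
qed

lemma word_class_zero: "word_class M \<zero>\<^bsub>word_algebra M\<^esub> = \<zero>\<^bsub>tensor_algebra M\<^esub>"
  by (simp add: word_class_def degree_part_def word_algebra_simps tensor_algebra_simps
      tensor_power_def quot_module_simps multilinear_coset_zero)

lemma word_class_single_word: "word_class M (single_word u) = pure_tensor M u"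
proof
  fix n
  have "degree_part n (single_word u :: 'a list \<Rightarrow> 'k) = (if n = length u then single_word u else (\<lambda>w. 0))"
    by (auto simp: degree_part_def single_word_def)
  then show "word_class M (single_word u) n = pure_tensor M u n"
    by (simp add: word_class_def pure_tensor_def multilinear_coset_zero tensor_power_def quot_module_simps)
qed

lemma word_class_mult:
  assumes f: "f \<in> carrier (word_algebra M)" and g: "g \<in> carrier (word_algebra M)"
  shows "word_class M (f \<otimes>\<^bsub>word_algebra M\<^esub> g) = word_class M f \<otimes>\<^bsub>tensor_algebra M\<^esub> word_class M g"
proof
  fix n
  let ?h = "\<lambda>i. degree_part i f \<otimes>\<^bsub>word_algebra M\<^esub> degree_part (n - i) g"
  have cl: "?h i \<in> carrier (free_tuples M n)" if "i \<in> {..n}" for i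
    using free_tuples_mult_closed[OF degree_part_closed[OF f, of i] degree_part_closed[OF g, of "n - i"]] that
    by simp
  interpret Q: abelian_group "tensor_power M n"
    unfolding tensor_power_def
    by (rule abelian_group_quot_module[OF module_free_tuples multilinear_relations_submodule[OF M]])
  have "(word_class M f \<otimes>\<^bsub>tensor_algebra M\<^esub> word_class M g) n =
      (\<Oplus>\<^bsub>tensor_power M n\<^esub>i\<in>{..n}. multilinear_relations M n +>\<^bsub>free_tuples M n\<^esub> ?h i)"
    unfolding tensor_algebra_simps
  proof (rule Q.finsum_cong')
    fix i assume "i \<in> {..n}"
    then show "tensor_concat M n (word_class M f i) (word_class M g (n - i)) =
        multilinear_relations M n +>\<^bsub>free_tuples M n\<^esub> ?h i"
      using tensor_concat_cosets[OF M degree_part_closed[OF f, of i] degree_part_closed[OF g, of "n - i"]]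
      by (simp add: word_class_def)
  qed (use cl in \<open>auto simp: tensor_power_def quot_module_simps\<close>)
  also have "\<dots> = multilinear_relations M n +>\<^bsub>free_tuples M n\<^esub> (\<lambda>w. \<Sum>i\<le>n. ?h i w)"
    unfolding tensor_power_def
    using quot_module_finsum[OF module_free_tuples multilinear_relations_submodule[OF M] finite_atMost, of n ?h n]
      free_tuples_finsum[OF finite_atMost, of n ?h M n] cl
    by (simp only:)
  also have "(\<lambda>w. \<Sum>i\<le>n. ?h i w) = degree_part n (f \<otimes>\<^bsub>word_algebra M\<^esub> g)"
  proof
    fix w
    show "(\<Sum>i\<le>n. ?h i w) = degree_part n (f \<otimes>\<^bsub>word_algebra M\<^esub> g) w"
    proof (cases "length w = n")
      case False
      then have "?h i w = 0" if "i \<le> n" for i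
        using cl[of i] that by (auto simp: free_tuples_carrier_iff)
      then show ?thesis using False by (simp add: degree_part_def)
    next
      case True
      \<comment> \<open>Among the cuts of \<open>w\<close>, only the one at \<open>i\<close> has a
        first piece of length \<open>i\<close>, so this convolution has a single term; summing over
        \<open>i\<close> restores the full product.\<close>
      have "?h i w = f (take i w) * g (drop i w)" if "i \<le> n" for i
      proof -
        have "?h i w = (\<Sum>k\<le>n. if k = i then f (take i w) * g (drop i w) else 0)"
          unfolding word_algebra_simps True
          by (rule sum.cong) (use True that in \<open>auto simp: degree_part_def\<close>)
        then show ?thesis using that by simp
      qed
      then show ?thesis using True by (simp add: degree_part_def word_algebra_simps)
    qed
  qed
  finally show "word_class M (f \<otimes>\<^bsub>word_algebra M\<^esub> g) n =
    (word_class M f \<otimes>\<^bsub>tensor_algebra M\<^esub> word_class M g) n"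
    by (simp add: word_class_def)
qed

lemma word_class_hom: "word_class M \<in> unital_algebra_homs (word_algebra M) (tensor_algebra M)"
proof (rule unital_algebra_homsI)
  show "word_class M \<one>\<^bsub>word_algebra M\<^esub> = \<one>\<^bsub>tensor_algebra M\<^esub>"
    by (simp add: word_algebra_simps tensor_algebra_simps word_class_single_word)
next
  fix f assume f: "f \<in> carrier (word_algebra M)"
  show "word_class M (c \<odot>\<^bsub>word_algebra M\<^esub> f) = c \<odot>\<^bsub>tensor_algebra M\<^esub> word_class M f" for c
  proof
    fix n
    have "degree_part n (c \<odot>\<^bsub>word_algebra M\<^esub> f) = c \<odot>\<^bsub>free_tuples M n\<^esub> degree_part n f"
      by (auto simp: degree_part_def word_algebra_simps free_tuples_simps)
    then show "word_class M (c \<odot>\<^bsub>word_algebra M\<^esub> f) n = (c \<odot>\<^bsub>tensor_algebra M\<^esub> word_class M f) n"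
      by (simp add: word_class_def tensor_algebra_simps tensor_power_def degree_part_closed[OF f]
          quot_module_smult[OF module_free_tuples multilinear_relations_submodule[OF M]])
  qed
next
  fix f g assume f: "f \<in> carrier (word_algebra M)" and g: "g \<in> carrier (word_algebra M)"
  show "word_class M (f \<oplus>\<^bsub>word_algebra M\<^esub> g) = word_class M f \<oplus>\<^bsub>tensor_algebra M\<^esub> word_class M g"
  proof
    fix n
    have "degree_part n (f \<oplus>\<^bsub>word_algebra M\<^esub> g) =
        degree_part n f \<oplus>\<^bsub>free_tuples M n\<^esub> degree_part n g"
      by (auto simp: degree_part_def word_algebra_simps free_tuples_simps)
    then show "word_class M (f \<oplus>\<^bsub>word_algebra M\<^esub> g) n =
        (word_class M f \<oplus>\<^bsub>tensor_algebra M\<^esub> word_class M g) n"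
      by (simp add: word_class_def tensor_algebra_simps tensor_power_def degree_part_closed f g
          quot_module_add[OF module_free_tuples multilinear_relations_submodule[OF M]])
  qed
qed (fact word_class_closed word_class_mult)+

lemma word_class_surj: "word_class M ` carrier (word_algebra M) = carrier (tensor_algebra M)"
proof (intro equalityI subsetI)
  fix t assume t: "t \<in> carrier (tensor_algebra M)"
  \<comment> \<open>The last conjunct selects the representative 0 for a zero class. Arbitrary
    representatives there could be nonzero in infinitely many degrees, and gluing them would not
    give a finite support.\<close>
  have "\<exists>f. f \<in> carrier (free_tuples M n) \<and> t n = multilinear_relations M n +>\<^bsub>free_tuples M n\<^esub> f \<and>
      (t n = multilinear_relations M n \<longrightarrow> f = (\<lambda>w. 0))" for n
  proof (cases "t n = multilinear_relations M n")
    case True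
    then show ?thesis
      by (intro exI[of _ "\<lambda>w. 0"])
        (simp add: multilinear_coset_zero free_tuples_carrier_iff word_algebra_carrier_iff)
  next
    case False
    then show ?thesis
      using t by (auto simp: tensor_algebra_carrier_iff tensor_power_def quot_module_simps)
  qed
  then obtain r where r: "\<And>n. r n \<in> carrier (free_tuples M n)"
      "\<And>n. t n = multilinear_relations M n +>\<^bsub>free_tuples M n\<^esub> r n"
      "\<And>n. t n = multilinear_relations M n \<Longrightarrow> r n = (\<lambda>w. 0)"
    by metis
  \<comment> \<open>The representatives are glued along word length, so that the part of degree
    \<open>n\<close> is exactly \<open>r n\<close>.\<close>
  define f where "f = (\<lambda>w. r (length w) w)"
  have "f \<in> carrier (word_algebra M)"
  proof (rule word_algebra_carrierI)
    show "finite (\<Union>n\<in>{n. t n \<noteq> multilinear_relations M n}. {w. r n w \<noteq> 0})"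
      using t r(1) by (auto simp: tensor_algebra_carrier_iff free_tuples_carrier_iff word_algebra_carrier_iff)
    show "(\<Union>n\<in>{n. t n \<noteq> multilinear_relations M n}. {w. r n w \<noteq> 0}) \<subseteq> lists (carrier M)"
      using r(1) by (auto simp: free_tuples_carrier_iff word_algebra_carrier_iff)
    show "w \<in> (\<Union>n\<in>{n. t n \<noteq> multilinear_relations M n}. {w. r n w \<noteq> 0})" if "f w \<noteq> 0" for w
      by (rule UN_I[of "length w"]) (use that r(3)[of "length w"] in \<open>auto simp: f_def\<close>)
  qed
  moreover have "degree_part n f = r n" for n
    using r(1)[of n] by (auto simp: degree_part_def f_def free_tuples_carrier_iff fun_eq_iff)
  then have "word_class M f = t" by (simp add: word_class_def r(2)[symmetric])
  ultimately show "t \<in> word_class M ` carrier (word_algebra M)" by blast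
qed (auto intro: word_class_closed)

lemma unital_algebra_tensor_algebra: "unital_algebra (tensor_algebra M)"
  by (rule unital_algebra_image[OF unital_algebra_word_algebra word_class_hom word_class_surj])
    (fact word_class_zero)

lemma pure_tensor_closed: "u \<in> lists (carrier M) \<Longrightarrow> pure_tensor M u \<in> carrier (tensor_algebra M)"
  using word_class_closed[OF single_word_closed] by (simp add: word_class_single_word)

section \<open>Universal property of the tensor algebra\<close>

context
  fixes A :: "('k, 'b) module" and \<phi> :: "'a \<Rightarrow> 'b"
  assumes A: "unital_algebra A" and \<phi>: "\<phi> \<in> linear_maps M A"
begin

interpretation A: unital_algebra A by (rule A)
interpretation M: module scalars M by (rule M)

private lemma \<phi>_closed: "\<phi> \<in> carrier M \<rightarrow> carrier A"
  using \<phi> by (simp add: linear_maps_def)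

private lemma eval_hom: "word_eval A \<phi> \<in> unital_algebra_homs (word_algebra M) A"
  by (rule word_eval_hom[OF A \<phi>_closed])

text \<open>Splitting the word around the slot isolates one factor, in which \<phi> is linear; left
  and right multiplication in \<open>A\<close> preserve this.\<close>

lemma word_prod_linear:
  assumes "x \<in> carrier M" "y \<in> carrier M" "u \<in> lists (carrier M)" "v \<in> lists (carrier M)"
  shows "word_prod A \<phi> (u @ [c \<odot>\<^bsub>M\<^esub> x \<oplus>\<^bsub>M\<^esub> d \<odot>\<^bsub>M\<^esub> y] @ v) =
    c \<odot>\<^bsub>A\<^esub> word_prod A \<phi> (u @ [x] @ v) \<oplus>\<^bsub>A\<^esub> d \<odot>\<^bsub>A\<^esub> word_prod A \<phi> (u @ [y] @ v)"
proof -
  note cl = word_prod_closed[OF A \<phi>_closed assms(3)] word_prod_closed[OF A \<phi>_closed assms(4)]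
  have \<phi>xy: "\<phi> x \<in> carrier A" "\<phi> y \<in> carrier A" using \<phi>_closed assms by auto
  have lin: "\<phi> (c \<odot>\<^bsub>M\<^esub> x \<oplus>\<^bsub>M\<^esub> d \<odot>\<^bsub>M\<^esub> y) = c \<odot>\<^bsub>A\<^esub> \<phi> x \<oplus>\<^bsub>A\<^esub> d \<odot>\<^bsub>A\<^esub> \<phi> y"
    using \<phi> assms by (simp add: linear_maps_def)
  have split: "word_prod A \<phi> (u @ [z] @ v) = word_prod A \<phi> u \<otimes>\<^bsub>A\<^esub> (\<phi> z \<otimes>\<^bsub>A\<^esub> word_prod A \<phi> v)"
    if "z \<in> carrier M" for z
    using word_prod_append[OF A \<phi>_closed assms(3), of "[z] @ v"] that assms(4) by simp
  have "c \<odot>\<^bsub>M\<^esub> x \<oplus>\<^bsub>M\<^esub> d \<odot>\<^bsub>M\<^esub> y \<in> carrier M" using assms by simp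
  then show ?thesis
    using cl \<phi>xy assms
    by (simp only: split lin)
      (simp add: A.l_distr A.r_distr A.mult_smult_left A.mult_smult_right)
qed

lemma word_eval_multilinear_relations:
  assumes "f \<in> multilinear_relations M n"
  shows "word_eval A \<phi> f = \<zero>\<^bsub>A\<^esub>"
  using assms
proof (induction f rule: multilinear_relations_induct[OF M, consumes 1, case_names relator zero add smult])
  case (relator c d x y u v)
  let ?s = "\<lambda>z. single_word (u @ [z] @ v) :: 'a list \<Rightarrow> 'k"
  let ?r = "\<lambda>w. ?s (c \<odot>\<^bsub>M\<^esub> x \<oplus>\<^bsub>M\<^esub> d \<odot>\<^bsub>M\<^esub> y) w - c * ?s x w - d * ?s y w"
  have xy: "c \<odot>\<^bsub>M\<^esub> x \<oplus>\<^bsub>M\<^esub> d \<odot>\<^bsub>M\<^esub> y \<in> carrier M" using relator by simp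
  have words: "u @ [z] @ v \<in> lists (carrier M)" if "z \<in> carrier M" for z
    using relator that by simp
  note s = single_word_closed[OF words] and e = word_eval_single_word[OF A \<phi>_closed words]
  note p = word_prod_closed[OF A \<phi>_closed words]
  have r: "?r \<in> carrier (word_algebra M)"
    using relator_closed[OF M relator] by (simp add: free_tuples_carrier_iff)
  \<comment> \<open>The relator is moved to the side of the sum, so that only addition and scalars
    have to be evaluated. With \<open>z\<close> the value of the linear combination, this yields z =
    \<open>word_eval A \<phi> ?r\<close> + z, and \<open>z\<close> cancels.\<close>
  have eq: "?s (c \<odot>\<^bsub>M\<^esub> x \<oplus>\<^bsub>M\<^esub> d \<odot>\<^bsub>M\<^esub> y) =
      ?r \<oplus>\<^bsub>word_algebra M\<^esub> (c \<odot>\<^bsub>word_algebra M\<^esub> ?s x \<oplus>\<^bsub>word_algebra M\<^esub> d \<odot>\<^bsub>word_algebra M\<^esub> ?s y)"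
    by (simp add: word_algebra_simps)
  define z where "z = c \<odot>\<^bsub>A\<^esub> word_prod A \<phi> (u @ [x] @ v) \<oplus>\<^bsub>A\<^esub> d \<odot>\<^bsub>A\<^esub> word_prod A \<phi> (u @ [y] @ v)"
  have z: "z \<in> carrier A" unfolding z_def using p[OF relator(1)] p[OF relator(2)] by simp
  have "z = word_eval A \<phi> (?s (c \<odot>\<^bsub>M\<^esub> x \<oplus>\<^bsub>M\<^esub> d \<odot>\<^bsub>M\<^esub> y))"
    unfolding e[OF xy] z_def by (rule word_prod_linear[symmetric]) (use relator in auto)
  also have "\<dots> = word_eval A \<phi> ?r \<oplus>\<^bsub>A\<^esub> z"
    unfolding z_def
    by (subst eq) (use r s[OF relator(1)] s[OF relator(2)] in
        \<open>simp only: unital_algebra_homsD[OF eval_hom] W.a_closed W.smult_closed scalars_simps UNIV_I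
          e[OF relator(1)] e[OF relator(2)]\<close>)
  finally show ?case
    by (rule A.add.r_cancel_one'[OF z word_eval_closed[OF A \<phi>_closed r], THEN iffD1])
next
  case zero
  show ?case using word_eval_zero[OF A \<phi>_closed] by (simp add: word_algebra_simps)
next
  case (add f g)
  then show ?case
    using word_eval_add[OF A \<phi>_closed, of f g] by (simp add: free_tuples_carrier_iff word_algebra_simps)
next
  case (smult c f)
  then show ?case
    using word_eval_smult[OF A \<phi>_closed, of f c] A.smult_r_null[of c]
    by (simp add: free_tuples_carrier_iff word_algebra_simps)
qed

text \<open>Equal classes mean that every homogeneous part of f - g is a multilinear relation and
  hence evaluates to zero. Finite support makes f - g a finite sum of such parts.\<close>

lemma word_eval_cong_word_class:
  assumes f: "f \<in> carrier (word_algebra M)" and g: "g \<in> carrier (word_algebra M)"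
    and eq: "word_class M f = word_class M g"
  shows "word_eval A \<phi> f = word_eval A \<phi> g"
proof -
  define h where "h = (\<lambda>w. f w - g w)"
  have "h = f \<oplus>\<^bsub>word_algebra M\<^esub> (-1) \<odot>\<^bsub>word_algebra M\<^esub> g"
    by (simp add: h_def word_algebra_simps)
  then have h: "h \<in> carrier (word_algebra M)" using f g by simp
  have hn: "degree_part n h \<in> multilinear_relations M n" for n
  proof -
    have "degree_part n h = (\<lambda>w. degree_part n f w - degree_part n g w)"
      by (auto simp: degree_part_def h_def)
    then show ?thesis
      using fun_cong[OF eq, of n] multilinear_coset_eq_iff[OF M degree_part_closed[OF f] degree_part_closed[OF g]]
      by (simp add: word_class_def)
  qed
  \<comment> \<open>The sum of the parts of degree below \<open>N\<close>. The strict bound makes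
    \<open>trunc 0\<close> zero and lets each successor add exactly the part of degree
    \<open>N\<close>; beyond the longest word of the support the truncation is
    \<open>h\<close>.\<close>
  define trunc where "trunc N = (\<lambda>w. if length w < N then h w else 0)" for N
  have trunc_closed: "trunc N \<in> carrier (word_algebra M)" for N
    by (rule word_algebra_carrierI[of "{w. h w \<noteq> 0}"])
      (use h in \<open>auto simp: trunc_def word_algebra_carrier_iff split: if_splits\<close>)
  have trunc: "word_eval A \<phi> (trunc N) = \<zero>\<^bsub>A\<^esub>" for N
  proof (induction N)
    case 0
    show ?case using word_eval_zero[OF A \<phi>_closed] by (simp add: trunc_def word_algebra_simps)
  next
    case (Suc N)
    have "trunc (Suc N) = trunc N \<oplus>\<^bsub>word_algebra M\<^esub> degree_part N h"
      by (auto simp: trunc_def degree_part_def word_algebra_simps)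
    moreover have "degree_part N h \<in> carrier (word_algebra M)"
      using degree_part_closed[OF h] by (auto simp: free_tuples_carrier_iff)
    ultimately show ?case
      using word_eval_add[OF A \<phi>_closed trunc_closed[of N]] Suc word_eval_multilinear_relations[OF hn]
      by simp
  qed
  have "finite (length ` {w. h w \<noteq> 0})" using h by (simp add: word_algebra_carrier_iff)
  then obtain N where "\<forall>n \<in> length ` {w. h w \<noteq> 0}. n < N"
    using finite_nat_set_iff_bounded by blast
  then have "trunc N = h" by (auto simp: trunc_def fun_eq_iff)
  then have "word_eval A \<phi> h = \<zero>\<^bsub>A\<^esub>" using trunc[of N] by simp
  moreover have "f = h \<oplus>\<^bsub>word_algebra M\<^esub> g" by (simp add: h_def word_algebra_simps)
  ultimately show ?thesis
    using word_eval_add[OF A \<phi>_closed h g] word_eval_closed[OF A \<phi>_closed g] by simp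
qed

lemma tensor_algebra_universal:
  "\<exists>\<psi> \<in> unital_algebra_homs (tensor_algebra M) A. \<forall>x\<in>carrier M. \<psi> (pure_tensor M [x]) = \<phi> x"
proof -
  obtain \<psi> where \<psi>: "\<psi> \<in> unital_algebra_homs (tensor_algebra M) A"
      "\<forall>f\<in>carrier (word_algebra M). \<psi> (word_class M f) = word_eval A \<phi> f"
    using unital_algebra_homs_factor[OF unital_algebra_word_algebra word_class_hom word_class_surj
        eval_hom word_eval_cong_word_class] by blast
  have "\<psi> (pure_tensor M [x]) = \<phi> x" if x: "x \<in> carrier M" for x
  proof -
    have "[x] \<in> lists (carrier M)" using x by simp
    moreover have "\<phi> x \<in> carrier A" using \<phi>_closed x by auto
    ultimately show ?thesis
      using \<psi>(2) single_word_closed[of "[x]" M] word_eval_single_word[OF A \<phi>_closed, of "[x]"]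
      by (simp add: word_class_single_word[symmetric])
  qed
  with \<psi>(1) show ?thesis by blast
qed

end

lemma tensor_algebra_homs_eqI:
  fixes A :: "('k, 'b) module"
  assumes A: "unital_algebra A"
    and g: "g \<in> unital_algebra_homs (tensor_algebra M) A"
    and h: "h \<in> unital_algebra_homs (tensor_algebra M) A"
    and eq: "\<And>x. x \<in> carrier M \<Longrightarrow> g (pure_tensor M [x]) = h (pure_tensor M [x])"
    and t: "t \<in> carrier (tensor_algebra M)"
  shows "g t = h t"
proof -
  obtain f where f: "f \<in> carrier (word_algebra M)" "t = word_class M f"
    using t word_class_surj by blast
  have "(g \<circ> word_class M) f = (h \<circ> word_class M) f"
    by (rule word_algebra_homs_eqI[OF A unital_algebra_homs_comp[OF word_class_hom g]
          unital_algebra_homs_comp[OF word_class_hom h] _ f(1)])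
      (simp add: word_class_single_word eq)
  then show ?thesis by (simp add: f)
qed

end

subsection \<open>The enveloping algebra\<close>

lemma (in superalgebra) component_closed: "x \<in> G i \<Longrightarrow> x \<in> carrier \<aa>"
  using submoduleE(1)[OF submodule_component] by blast

lemma enveloping_relations_cases:
  fixes \<aa> :: "('k::real_normed_field, 'a) module"
  assumes "r \<in> enveloping_relations \<aa> G"
  obtains
    (odd_odd) a b where "a \<in> G 1" "b \<in> G 1"
      "r = (1/2) \<odot>\<^bsub>tensor_algebra \<aa>\<^esub>
        (pure_tensor \<aa> [a] \<otimes>\<^bsub>tensor_algebra \<aa>\<^esub> pure_tensor \<aa> [b] \<ominus>\<^bsub>tensor_algebra \<aa>\<^esub>
         pure_tensor \<aa> [b] \<otimes>\<^bsub>tensor_algebra \<aa>\<^esub> pure_tensor \<aa> [a])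
        \<ominus>\<^bsub>tensor_algebra \<aa>\<^esub> pure_tensor \<aa> [a \<otimes>\<^bsub>\<aa>\<^esub> b]"
  | (odd_even) a x where "a \<in> G 1" "x \<in> G 0"
      "r = (1/2) \<odot>\<^bsub>tensor_algebra \<aa>\<^esub>
        (pure_tensor \<aa> [a] \<otimes>\<^bsub>tensor_algebra \<aa>\<^esub> pure_tensor \<aa> [x] \<oplus>\<^bsub>tensor_algebra \<aa>\<^esub>
         pure_tensor \<aa> [x] \<otimes>\<^bsub>tensor_algebra \<aa>\<^esub> pure_tensor \<aa> [a])
        \<ominus>\<^bsub>tensor_algebra \<aa>\<^esub> pure_tensor \<aa> [a \<otimes>\<^bsub>\<aa>\<^esub> x]"
  | (even_even) x y where "x \<in> G 0" "y \<in> G 0"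
      "r = pure_tensor \<aa> [x] \<otimes>\<^bsub>tensor_algebra \<aa>\<^esub> pure_tensor \<aa> [y]
        \<ominus>\<^bsub>tensor_algebra \<aa>\<^esub> pure_tensor \<aa> [x \<otimes>\<^bsub>\<aa>\<^esub> y]"
  using assms unfolding enveloping_relations_def Let_def by blast

text \<open>Serves \<open>genideal_ideal\<close>, which asks for generators inside the
  carrier.\<close>

lemma enveloping_relations_closed:
  assumes "superalgebra \<aa> G"
  shows "enveloping_relations \<aa> G \<subseteq> carrier (tensor_algebra \<aa>)"
proof
  interpret \<aa>: superalgebra \<aa> G by (rule assms)
  let ?T = "tensor_algebra \<aa>"
  interpret T: unital_algebra ?T by (rule unital_algebra_tensor_algebra[OF \<aa>.module_axioms])
  note G = \<aa>.component_closed
  have j: "pure_tensor \<aa> [x] \<in> carrier ?T" if "x \<in> carrier \<aa>" for x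
    by (rule pure_tensor_closed[OF \<aa>.module_axioms]) (use that in simp)
  fix r assume "r \<in> enveloping_relations \<aa> G"
  then show "r \<in> carrier ?T"
    by (cases rule: enveloping_relations_cases) (simp_all add: j G \<aa>.mult_closed)
qed

text \<open>The Koszul sign turns \<open>super\<close> into half a commutator on two odd elements
  and half an anticommutator on a mixed pair, which are the shapes of the first two families of
  relations. The even family needs \<open>comm\<close> as well.\<close>

lemma enveloping_relations_in_kernel:
  fixes \<aa> :: "('k::real_normed_field, 'a) module" and A :: "('k, 'b) module"
  assumes \<aa>: "superalgebra \<aa> G" and A: "unital_algebra A"
    and \<psi>: "\<psi> \<in> unital_algebra_homs (tensor_algebra \<aa>) A"
    and super: "\<And>i j x y. x \<in> G i \<Longrightarrow> y \<in> G j \<Longrightarrow>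
      \<psi> (pure_tensor \<aa> [x \<otimes>\<^bsub>\<aa>\<^esub> y]) =
        (1/2) \<odot>\<^bsub>A\<^esub> (\<psi> (pure_tensor \<aa> [x]) \<otimes>\<^bsub>A\<^esub> \<psi> (pure_tensor \<aa> [y]) \<oplus>\<^bsub>A\<^esub>
          koszul_sign i j \<odot>\<^bsub>A\<^esub> (\<psi> (pure_tensor \<aa> [y]) \<otimes>\<^bsub>A\<^esub> \<psi> (pure_tensor \<aa> [x])))"
    and comm: "\<And>x y. x \<in> G 0 \<Longrightarrow> y \<in> G 0 \<Longrightarrow>
      \<psi> (pure_tensor \<aa> [x]) \<otimes>\<^bsub>A\<^esub> \<psi> (pure_tensor \<aa> [y]) =
      \<psi> (pure_tensor \<aa> [y]) \<otimes>\<^bsub>A\<^esub> \<psi> (pure_tensor \<aa> [x])"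
  shows "enveloping_relations \<aa> G \<subseteq> a_kernel (tensor_algebra \<aa>) A \<psi>"
proof
  interpret \<aa>: superalgebra \<aa> G by (rule \<aa>)
  interpret A: unital_algebra A by (rule A)
  let ?T = "tensor_algebra \<aa>"
  interpret T: unital_algebra ?T by (rule unital_algebra_tensor_algebra[OF \<aa>.module_axioms])
  interpret \<psi>: ring_hom_ring ?T A \<psi>
    by (rule unital_algebra_homs_ring_hom_ring[OF \<psi> T.ring_axioms A.ring_axioms])
  let ?j = "\<lambda>x. pure_tensor \<aa> [x]"
  note G = \<aa>.component_closed
  have j: "?j x \<in> carrier ?T" if "x \<in> carrier \<aa>" for x
    by (rule pure_tensor_closed[OF \<aa>.module_axioms]) (use that in simp)
  note mult = \<aa>.mult_closed
  have minus: "\<psi> (s \<ominus>\<^bsub>?T\<^esub> t) = \<psi> s \<ominus>\<^bsub>A\<^esub> \<psi> t" if "s \<in> carrier ?T" "t \<in> carrier ?T" for s t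
    using that by (simp add: a_minus_def)
  fix r assume "r \<in> enveloping_relations \<aa> G"
  then have "r \<in> carrier ?T" using enveloping_relations_closed[OF \<aa>] by blast
  moreover from \<open>r \<in> enveloping_relations \<aa> G\<close> have "\<psi> r = \<zero>\<^bsub>A\<^esub>"
  proof (cases rule: enveloping_relations_cases)
    case (odd_odd a b)
    note cl = j[OF G[OF odd_odd(1)]] j[OF G[OF odd_odd(2)]]
      j[OF mult[OF G[OF odd_odd(1)] G[OF odd_odd(2)]]]
    have "\<psi> (?j (a \<otimes>\<^bsub>\<aa>\<^esub> b)) = (1/2) \<odot>\<^bsub>A\<^esub> (\<psi> (?j a) \<otimes>\<^bsub>A\<^esub> \<psi> (?j b) \<ominus>\<^bsub>A\<^esub> \<psi> (?j b) \<otimes>\<^bsub>A\<^esub> \<psi> (?j a))"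
      using super[OF odd_odd(1,2)] smult_minus_one[OF A.module_axioms] cl
      by (simp add: koszul_sign_def a_minus_def)
    then show ?thesis
      using cl by (simp add: odd_odd(3) minus unital_algebra_homsD(5)[OF \<psi>] A.r_neg a_minus_def)
  next
    case (odd_even a x)
    note cl = j[OF G[OF odd_even(1)]] j[OF G[OF odd_even(2)]]
      j[OF mult[OF G[OF odd_even(1)] G[OF odd_even(2)]]]
    have "\<psi> (?j (a \<otimes>\<^bsub>\<aa>\<^esub> x)) = (1/2) \<odot>\<^bsub>A\<^esub> (\<psi> (?j a) \<otimes>\<^bsub>A\<^esub> \<psi> (?j x) \<oplus>\<^bsub>A\<^esub> \<psi> (?j x) \<otimes>\<^bsub>A\<^esub> \<psi> (?j a))"
      using super[OF odd_even(1,2)] A.smult_one cl by (simp add: koszul_sign_def)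
    then show ?thesis
      using cl by (simp add: odd_even(3) minus unital_algebra_homsD(5)[OF \<psi>] A.r_neg a_minus_def)
  next
    case (even_even x y)
    note cl = j[OF G[OF even_even(1)]] j[OF G[OF even_even(2)]]
      j[OF mult[OF G[OF even_even(1)] G[OF even_even(2)]]]
    \<comment> \<open>By \<open>comm\<close> both products in the half-sum equal \<open>p\<close>,
      and 1/2 p + 1/2 p = p matches the even relation.\<close>
    define p where "p = \<psi> (?j x) \<otimes>\<^bsub>A\<^esub> \<psi> (?j y)"
    have p: "p \<in> carrier A" unfolding p_def using cl by simp
    have "\<psi> (?j (x \<otimes>\<^bsub>\<aa>\<^esub> y)) = (1/2) \<odot>\<^bsub>A\<^esub> (p \<oplus>\<^bsub>A\<^esub> p)"
      using super[OF even_even(1,2)] comm[OF even_even(1,2)] A.smult_one p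
      by (simp add: koszul_sign_def p_def)
    also have "\<dots> = (1/2) \<odot>\<^bsub>A\<^esub> p \<oplus>\<^bsub>A\<^esub> (1/2) \<odot>\<^bsub>A\<^esub> p" using A.smult_r_distr[of "1/2" p p] p by simp
    also have "\<dots> = p" using A.smult_l_distr[of "1/2" "1/2" p] A.smult_one[OF p] p by simp
    finally show ?thesis
      using cl p by (simp add: even_even(3) minus p_def A.r_neg a_minus_def)
  qed
  ultimately show "r \<in> a_kernel ?T A \<psi>" unfolding a_kernel_def' by blast
qed

theorem proposition2p1:
  fixes \<aa> :: "('k::real_normed_field, 'a) module" and G :: "bit \<Rightarrow> 'a set"
    and A :: "('k, 'b) module" and H :: "bit \<Rightarrow> 'b set"
    and \<phi> :: "'a \<Rightarrow> 'b"
  assumes "lie_antialgebra \<aa> G"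
    and "assoc_superalgebra A H"
    and "\<phi> \<in> linear_maps \<aa> A"
    and "\<And>i j x y. x \<in> G i \<Longrightarrow> y \<in> G j \<Longrightarrow>
      \<phi> (x \<otimes>\<^bsub>\<aa>\<^esub> y) =
        (1/2) \<odot>\<^bsub>A\<^esub> (\<phi> x \<otimes>\<^bsub>A\<^esub> \<phi> y \<oplus>\<^bsub>A\<^esub> koszul_sign i j \<odot>\<^bsub>A\<^esub> (\<phi> y \<otimes>\<^bsub>A\<^esub> \<phi> x))"
    and "\<And>x y. x \<in> G 0 \<Longrightarrow> y \<in> G 0 \<Longrightarrow> \<phi> x \<otimes>\<^bsub>A\<^esub> \<phi> y = \<phi> y \<otimes>\<^bsub>A\<^esub> \<phi> x"
  shows "\<exists>!\<phi>'. \<phi>' \<in> unital_algebra_homs (enveloping_algebra \<aa> G) A \<and>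
    \<phi>' \<in> extensional (carrier (enveloping_algebra \<aa> G)) \<and>
    (\<forall>x\<in>carrier \<aa>. \<phi>' (enveloping_map \<aa> G x) = \<phi> x)"
proof -
  interpret \<aa>: lie_antialgebra \<aa> G by (rule assms(1))
  have A: "unital_algebra A" by (rule assoc_superalgebra.unital_algebra[OF assms(2)])
  interpret A: unital_algebra A by (rule A)
  let ?T = "tensor_algebra \<aa>" and ?U = "enveloping_algebra \<aa> G" and ?I = "enveloping_ideal \<aa> G"
  let ?\<pi> = "\<lambda>t. ?I +>\<^bsub>?T\<^esub> t"
  have T: "unital_algebra ?T" by (rule unital_algebra_tensor_algebra[OF \<aa>.module_axioms])
  interpret T: unital_algebra ?T by (rule T)
  have I: "ideal ?I ?T"
    unfolding enveloping_ideal_def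
    by (rule T.genideal_ideal[OF enveloping_relations_closed[OF \<aa>.superalgebra_axioms]])
  note I_sub = T.ideal_submodule[OF I]
  have \<pi>: "?\<pi> \<in> unital_algebra_homs ?T ?U"
    unfolding enveloping_algebra_def by (rule T.quotient_hom[OF I])
  have surj: "?\<pi> ` carrier ?T = carrier ?U"
    by (simp add: enveloping_algebra_def quot_module_simps)
  have U: "unital_algebra ?U"
    by (rule unital_algebra_image[OF T \<pi> surj])
      (simp add: enveloping_algebra_def quot_module_simps coset_zero[OF T.module_axioms I_sub])
  have \<iota>: "?\<pi> (pure_tensor \<aa> [x]) = enveloping_map \<aa> G x" for x
    by (simp add: enveloping_map_def)

  obtain \<psi> where \<psi>: "\<psi> \<in> unital_algebra_homs ?T A"
      "\<And>x. x \<in> carrier \<aa> \<Longrightarrow> \<psi> (pure_tensor \<aa> [x]) = \<phi> x"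
    using tensor_algebra_universal[OF \<aa>.module_axioms A assms(3)] by blast
  interpret \<psi>: ring_hom_ring ?T A \<psi>
    by (rule unital_algebra_homs_ring_hom_ring[OF \<psi>(1) T.ring_axioms A.ring_axioms])
  note G = \<aa>.component_closed
  have "enveloping_relations \<aa> G \<subseteq> a_kernel ?T A \<psi>"
  proof (rule enveloping_relations_in_kernel[OF \<aa>.superalgebra_axioms A \<psi>(1)])
    fix i j x y assume "x \<in> G i" "y \<in> G j"
    then show "\<psi> (pure_tensor \<aa> [x \<otimes>\<^bsub>\<aa>\<^esub> y]) =
        (1/2) \<odot>\<^bsub>A\<^esub> (\<psi> (pure_tensor \<aa> [x]) \<otimes>\<^bsub>A\<^esub> \<psi> (pure_tensor \<aa> [y]) \<oplus>\<^bsub>A\<^esub>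
          koszul_sign i j \<odot>\<^bsub>A\<^esub> (\<psi> (pure_tensor \<aa> [y]) \<otimes>\<^bsub>A\<^esub> \<psi> (pure_tensor \<aa> [x])))"
      using assms(4)[of x i y j] by (simp only: \<psi>(2) G \<aa>.mult_closed)
  next
    fix x y assume "x \<in> G 0" "y \<in> G 0"
    then show "\<psi> (pure_tensor \<aa> [x]) \<otimes>\<^bsub>A\<^esub> \<psi> (pure_tensor \<aa> [y]) =
        \<psi> (pure_tensor \<aa> [y]) \<otimes>\<^bsub>A\<^esub> \<psi> (pure_tensor \<aa> [x])"
      using assms(5)[of x y] by (simp only: \<psi>(2) G)
  qed
  then have ker: "?I \<subseteq> a_kernel ?T A \<psi>"
    unfolding enveloping_ideal_def by (rule T.genideal_minimal[OF \<psi>.kernel_is_ideal])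
  have "\<exists>g \<in> unital_algebra_homs ?U A. \<forall>t\<in>carrier ?T. g (?\<pi> t) = \<psi> t"
  proof (rule unital_algebra_homs_factor[OF T \<pi> surj \<psi>(1)])
    \<comment> \<open>Equal cosets differ by an element of the ideal, and the ideal lies in the
      kernel of \<psi>.\<close>
    fix s t assume st: "s \<in> carrier ?T" "t \<in> carrier ?T" and "?\<pi> s = ?\<pi> t"
    then have "s \<ominus>\<^bsub>?T\<^esub> t \<in> a_kernel ?T A \<psi>"
      using ker coset_eq_iff[OF T.module_axioms I_sub st] by blast
    then have "\<psi> (s \<ominus>\<^bsub>?T\<^esub> t) = \<zero>\<^bsub>A\<^esub>" unfolding a_kernel_def' by blast
    then have "\<psi> s \<ominus>\<^bsub>A\<^esub> \<psi> t = \<zero>\<^bsub>A\<^esub>" using st by (simp add: a_minus_def)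
    then show "\<psi> s = \<psi> t" using st by simp
  qed
  then obtain g where g: "g \<in> unital_algebra_homs ?U A" "\<And>t. t \<in> carrier ?T \<Longrightarrow> g (?\<pi> t) = \<psi> t"
    by blast
  have jT: "pure_tensor \<aa> [x] \<in> carrier ?T" if "x \<in> carrier \<aa>" for x
    by (rule pure_tensor_closed[OF \<aa>.module_axioms]) (use that in simp)
  show ?thesis
  \<comment> \<open>Functions are total, and \<open>g\<close> is unspecified off the carrier of the
    enveloping algebra. Its restriction has the fixed default value there that
    \<open>extensional\<close> demands, so uniqueness need only be checked on the carrier.\<close>
  proof (rule ex1I[of _ "restrict g (carrier ?U)"], intro conjI ballI)
    show "restrict g (carrier ?U) \<in> unital_algebra_homs ?U A"
      by (rule unital_algebra_homs_restrict[OF U g(1)])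
    fix x assume x: "x \<in> carrier \<aa>"
    have "enveloping_map \<aa> G x \<in> carrier ?U"
      unfolding \<iota>[symmetric] by (rule unital_algebra_homsD(1)[OF \<pi> jT[OF x]])
    then show "restrict g (carrier ?U) (enveloping_map \<aa> G x) = \<phi> x"
      using g(2)[OF jT[OF x]] \<psi>(2)[OF x] by (simp add: \<iota>)
  next
    fix h assume h: "h \<in> unital_algebra_homs ?U A \<and> h \<in> extensional (carrier ?U) \<and>
      (\<forall>x\<in>carrier \<aa>. h (enveloping_map \<aa> G x) = \<phi> x)"
    show "h = restrict g (carrier ?U)"
    proof (rule extensionalityI[of _ "carrier ?U"])
      fix u assume "u \<in> carrier ?U"
      then obtain t where t: "t \<in> carrier ?T" "u = ?\<pi> t" using surj by blast
      \<comment> \<open>Composed with the projection, both maps are morphisms on the tensor algebra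
        with value \<phi> x on each degree one tensor, so they agree; surjectivity of the projection
        carries this over to the quotient.\<close>
      have "(h \<circ> ?\<pi>) t = (g \<circ> ?\<pi>) t"
        by (rule tensor_algebra_homs_eqI[OF \<aa>.module_axioms A unital_algebra_homs_comp[OF \<pi>]
              unital_algebra_homs_comp[OF \<pi> g(1)] _ t(1)])
          (use h g(2)[OF jT] \<psi>(2) in \<open>simp_all add: \<iota>\<close>)
      then show "h u = restrict g (carrier ?U) u" using t \<open>u \<in> carrier ?U\<close> by simp
    qed (use h in auto)
  qed auto
qed

end
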